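(* Let $k\ge2$ and let $f$ be a nonnegative, nondegenerate real-valued $k$-regular sequence with canonical linear representation $(\mathbf u,\mathcal A,\mathbf v)$. Assume that all matrices $\widetilde{\mathbf A}_i$ ($0\le i\le k-1$) are nonnegative and that $\mathbf v$ is nonnegative. Then the pure point part of every ghost measure of $f$ is supported on $\mathbb Q$.
   Context: Regular sequences. Fix an integer $k\ge2$. For $n\ge1$ let $(n)_k=i_s\cdots i_0$ be the base-$k$ expansion ($i_s\ne0$), and for $d\times d$ matrices $\mathbf A_0,\dots,\mathbf A_{k-1}$ put $\mathbf A_{(n)_k}=\mathbf A_{i_s}\cdots\mathbf A_{i_0}$, with $\mathbf A_{(0)_k}$ the identity. A real sequence $f=(f(n))_{n\ge0}$ is $k$-regular if its $k$-kernel $\ker_k(f)=\{(f(k^\ell n+r))_{n\ge 0}:\ell\ge0,\ 0\le r<k^\ell\}$ spans a finite-dimensional real vector space $V_k(f)$. A linear representation of $f$ of degree $d$ is a tuple $(\mathbf u,\mathcal A,\mathbf v)$ with $\mathbf u,\mathbf v\in\mathbb R^{d}$, $\mathcal A=\{\mathbf A_0,\dots,\mathbf A_{k-1}\}\subset\mathbb R^{d\times d}$ and $f(n)=\mathbf u^T\mathbf A_{(n)_k}\mathbf v$ for all $n\ge 0$; it is minimal if $d=\dim V_k(f)$. It is canonical if it arises as follows: $\{f_1,\dots,f_d\}\subset\ker_k(f)$ is a basis of $V_k(f)$, $\mathbf f(n)=(f_1(n),\dots,f_d(n))^T$, the $\mathbf A_j$ satisfy $\mathbf f(kn+j)^T=\mathbf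 f(n)^T\mathbf A_j$ for all $n\ge0$ and $0\le j\le k-1$, $\mathbf u=\mathbf f(0)$, and $f(n)=\mathbf u^T\mathbf A_{(n)_k}\mathbf v$ for all $n\ge 0$. Put $\mathbf A=\sum_{j=0}^{k-1}\mathbf A_j$. Ghost measures. For nonnegative $f$ put $\Sigma_f(N)=\sum_{m=k^N}^{k^{N+1}-1}f(m)$ and, when $\Sigma_f(N)\neq0$, $\mu_N=\frac1{\Sigma_f(N)}\sum_{m=0}^{k^{N+1}-k^N-1}f(k^N+m)\,\delta_{m/(k^N(k-1))}$, a probability measure on $\mathbb T=[0,1)$ with addition mod $1$. Ghost measures of $f$ are the weak accumulation points of $(\mu_N)_N$. Restrictions and nondegeneracy. Given a linear representation, let $V\subset\mathbb R^d$ be the subspace with $V^T=\mathrm{span}\{\mathbf u^T\mathbf A_{(n)_k}:n\ge1\}$, $\mathbf P_V$ the orthogonal projection onto $V$, $\widetilde{\mathbf A}_i=\mathbf P_V\mathbf A_i\mathbf P_V$, $\widetilde{\mathbf A}=\mathbf P_V\mathbf A\mathbf P_V$, $\rho=\rho(\widetilde{\mathbf A})$ the spectral radius, $\{g_1\rho,\dots,g_s\rho\}$ ($|g_i|=1$) the eigenvalues of $\widetilde{\mathbf A}$ of modulus $\rho$, $g=(g_1,\dots,g_s)$ and $G=\overline{\{g^n:n\in\mathbb N\}}$ (closure in the $s$-fold product of the complex unit circle). For $h\in G$ let $\mathbf R_h$ be multiplication by $h_m$ on the generalised eigenspace in $V$ (complexified) of $\widetilde{\mathbf A}$ for $g_m\rho$,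 and the identity on the other generalised eigenspaces in $V$ and on $V^\perp$; $\mathbf R=\mathbf R_{g^{-1}}$. Let $r$ be the maximal size of a Jordan block of $\widetilde{\mathbf A}$ for an eigenvalue of modulus $\rho$, $c_n=\frac{(r-1)!}{n^{r-1}\rho^{n-r+1}}$, $\mathbf P=\lim_{n\to\infty}c_n\mathbf R^n\widetilde{\mathbf A}^n$ (the limit exists). The representation is nondegenerate if $\rho>0$ and $\mathbf u^T(\mathbf A-\mathbf A_0)\mathbf R_h\mathbf P\mathbf v>0$ for all $h\in G$; $f$ is nondegenerate if it has a minimal nondegenerate linear representation. *)

theory Defs
  imports
    "Jordan_Normal_Form.Spectral_Radius"
    "HOL-Library.Function_Algebras"
    "HOL-Probability.Probability"
begin

no_notation Matrix.vec_index (infixl \<open>$\<close> 100)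

abbreviation seq_scale :: "real \<Rightarrow> (nat \<Rightarrow> real) \<Rightarrow> nat \<Rightarrow> real" where
  "seq_scale c f \<equiv> (\<lambda>n. c * f n)"

lemma vector_space_seq_scale: "Vector_Spaces.vector_space seq_scale"
  by unfold_locales (auto simp: fun_eq_iff algebra_simps)

abbreviation seq_span :: "(nat \<Rightarrow> real) set \<Rightarrow> (nat \<Rightarrow> real) set" where
  "seq_span \<equiv> Modules.module.span seq_scale"

definition kernel :: "nat \<Rightarrow> (nat \<Rightarrow> real) \<Rightarrow> (nat \<Rightarrow> real) set" where
  "kernel k f = {\<lambda>n. f (k ^ l * n + r) | l r. r < k ^ l}"

definition kernel_space :: "nat \<Rightarrow> (nat \<Rightarrow> real) \<Rightarrow> (nat \<Rightarrow> real) set" where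
  "kernel_space k f = seq_span (kernel k f)"

definition k_regular :: "nat \<Rightarrow> (nat \<Rightarrow> real) \<Rightarrow> bool" where
  "k_regular k f \<longleftrightarrow> (\<exists>B. finite B \<and> kernel_space k f = seq_span B)"

text \<open>
  If \<open>i\<^sub>s\<dots>i\<^sub>0\<close> is the base-\<open>k\<close> expansion of \<open>n > 0\<close>, then \<open>digit_prod k A n\<close> is the product
  \<open>A i\<^sub>s ** \<dots> ** A i\<^sub>0\<close>, with the least significant digit rightmost.  The test \<open>k < 2\<close> only
  serves termination.
\<close>

function digit_prod :: "nat \<Rightarrow> (nat \<Rightarrow> real^'d^'d) \<Rightarrow> nat \<Rightarrow> real^'d^'d" where
  "digit_prod k A n =
     (if n = 0 \<or> k < 2 then Finite_Cartesian_Product.mat 1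
      else digit_prod k A (n div k) ** A (n mod k))"
  by auto
termination
  by (relation "Wellfounded.measure (\<lambda>(k, A, n). n)") auto

declare digit_prod.simps [simp del]

lemma digit_prod_0: "digit_prod k A 0 = Finite_Cartesian_Product.mat 1"
  by (simp add: digit_prod.simps)

lemma digit_prod_step:
  assumes "k \<ge> 2" "j < k" "k * n + j \<noteq> 0"
  shows "digit_prod k A (k * n + j) = digit_prod k A n ** A j"
  using assms by (subst digit_prod.simps) auto

text \<open>
  The degree of a representation is the cardinality of the index type \<open>'d\<close>; only the matrices
  \<open>A j\<close> with \<open>j < k\<close> are relevant.
\<close>

definition linear_rep ::
  "nat \<Rightarrow> (nat \<Rightarrow> real) \<Rightarrow> real^'d \<Rightarrow> (nat \<Rightarrow> real^'d^'d) \<Rightarrow> real^'d \<Rightarrow> bool" where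
  "linear_rep k f u A v \<longleftrightarrow> (\<forall>n. f n = inner u (digit_prod k A n *v v))"

definition minimal_rep ::
  "nat \<Rightarrow> (nat \<Rightarrow> real) \<Rightarrow> real^'d \<Rightarrow> (nat \<Rightarrow> real^'d^'d) \<Rightarrow> real^'d \<Rightarrow> bool" where
  "minimal_rep k f u A v \<longleftrightarrow>
     linear_rep k f u A v \<and>
     CARD('d) = Vector_Spaces.vector_space.dim seq_scale (kernel_space k f)"

definition canonical_rep ::
  "nat \<Rightarrow> (nat \<Rightarrow> real) \<Rightarrow> real^'d \<Rightarrow> (nat \<Rightarrow> real^'d^'d) \<Rightarrow> real^'d \<Rightarrow> bool" where
  "canonical_rep k f u A v \<longleftrightarrow>
     (\<exists>F :: 'd \<Rightarrow> nat \<Rightarrow> real.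
        inj F \<and> range F \<subseteq> kernel k f \<and>
        \<not> Modules.module.dependent seq_scale (range F) \<and>
        seq_span (range F) = kernel_space k f \<and>
        (\<forall>n. \<forall>j<k. (\<chi> i. F i (k * n + j)) = (\<chi> i. F i n) v* A j) \<and>
        u = (\<chi> i. F i 0)) \<and>
     linear_rep k f u A v"

definition reach_space :: "nat \<Rightarrow> real^'d \<Rightarrow> (nat \<Rightarrow> real^'d^'d) \<Rightarrow> (real^'d) set" where
  "reach_space k u A = span {u v* digit_prod k A n | n. n \<ge> 1}"

definition orth_proj :: "(real^'d) set \<Rightarrow> real^'d^'d" where
  "orth_proj V = matrix (\<lambda>x. THE y. y \<in> V \<and> x - y \<in> orthogonal_comp V)"

lemma
  fixes V :: "(real^'d) set"
  assumes "real_vector.subspace V"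
  shows orth_proj_in: "orth_proj V *v x \<in> V"
    and orth_proj_diff: "x - orth_proj V *v x \<in> orthogonal_comp V"
proof -
  define Q where "Q = (\<lambda>x. THE y. y \<in> V \<and> x - y \<in> orthogonal_comp V)"
  have uniq: "y = z"
    if y: "y \<in> V" "x - y \<in> orthogonal_comp V" and z: "z \<in> V" "x - z \<in> orthogonal_comp V"
    for x y z :: "real^'d"
  proof -
    have "y - z \<in> V"
      using \<open>real_vector.subspace V\<close> y z by (simp add: subspace_diff)
    moreover have "(x - z) - (x - y) \<in> orthogonal_comp V"
      by (rule subspace_diff[OF subspace_orthogonal_comp z(2) y(2)])
    then have "y - z \<in> orthogonal_comp V"
      by simp
    ultimately have "inner (y - z) (y - z) = 0"
      unfolding orthogonal_comp_def orthogonal_def by blast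
    then show ?thesis by simp
  qed
  have ex: "\<exists>y. y \<in> V \<and> x - y \<in> orthogonal_comp V" for x :: "real^'d"
  proof -
    obtain y z where yz: "y \<in> span V" "\<And>w. w \<in> span V \<Longrightarrow> orthogonal z w" "x = y + z"
      using orthogonal_subspace_decomp_exists[of V x] by metis
    have "span V = V"
      using \<open>real_vector.subspace V\<close> by simp
    note yz = yz[unfolded this]
    have "y \<in> V \<and> x - y \<in> orthogonal_comp V"
      unfolding orthogonal_comp_def using yz by (auto simp: orthogonal_def inner_commute)
    then show ?thesis ..
  qed
  have Q: "Q x \<in> V \<and> x - Q x \<in> orthogonal_comp V" for x
    unfolding Q_def by (rule theI') (use ex uniq in blast)
  have "linear Q"
  proof (rule linearI)
    show "Q (x + y) = Q x + Q y" for x y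
    proof (rule uniq[of _ "x + y"])
      show "x + y - (Q x + Q y) \<in> orthogonal_comp V"
        using Q[of x] Q[of y] subspace_add[OF subspace_orthogonal_comp, of "x - Q x" V "y - Q y"]
        by (simp add: algebra_simps)
    qed (use Q \<open>real_vector.subspace V\<close> in \<open>auto simp: subspace_add\<close>)
    show "Q (c *\<^sub>R x) = c *\<^sub>R Q x" for c x
    proof (rule uniq[of _ "c *\<^sub>R x"])
      show "c *\<^sub>R x - c *\<^sub>R Q x \<in> orthogonal_comp V"
        using Q[of x] subspace_scale[OF subspace_orthogonal_comp, of "x - Q x" V c]
        by (simp add: algebra_simps)
    qed (use Q \<open>real_vector.subspace V\<close> in \<open>auto simp: subspace_scale\<close>)
  qed
  then have "orth_proj V *v x = Q x"
    unfolding orth_proj_def Q_def[symmetric] by (simp add: matrix_works)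
  with Q show "orth_proj V *v x \<in> V" "x - orth_proj V *v x \<in> orthogonal_comp V"
    by auto
qed

definition restr_mat ::
  "nat \<Rightarrow> real^'d \<Rightarrow> (nat \<Rightarrow> real^'d^'d) \<Rightarrow> real^'d^'d \<Rightarrow> real^'d^'d" where
  "restr_mat k u A M = orth_proj (reach_space k u A) ** M ** orth_proj (reach_space k u A)"

definition total_mat :: "nat \<Rightarrow> (nat \<Rightarrow> real^'d^'d) \<Rightarrow> real^'d^'d" where
  "total_mat k A = (\<Sum>j<k. A j)"

abbreviation cvec :: "real^'d \<Rightarrow> complex^'d" where
  "cvec x \<equiv> (\<chi> i. complex_of_real (x $ i))"

abbreviation cmat :: "real^'d^'d \<Rightarrow> complex^'d^'d" where
  "cmat \<equiv> map_matrix complex_of_real"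

definition matpow :: "complex^'d^'d \<Rightarrow> nat \<Rightarrow> complex^'d^'d" where
  "matpow M n = (((**) M) ^^ n) (Finite_Cartesian_Product.mat 1)"

text \<open>
  The same matrix with rows and columns numbered from \<open>0\<close>, which makes the spectral notions and
  the Jordan normal form of \<open>'a mat\<close> available; these do not depend on the numbering.
\<close>

definition cmat_of :: "complex^'d^'d \<Rightarrow> complex Matrix.mat" where
  "cmat_of M = Matrix.mat CARD('d) CARD('d)
     (\<lambda>(i, j). M $ from_nat_into UNIV i $ from_nat_into UNIV j)"

definition rho :: "complex^'d^'d \<Rightarrow> real" where
  "rho M = spectral_radius (cmat_of M)"

definition peripheral :: "complex^'d^'d \<Rightarrow> complex set" where
  "peripheral M = {z. eigenvalue (cmat_of M) z \<and> cmod z = rho M}"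

definition max_jordan_block :: "complex^'d^'d \<Rightarrow> nat" where
  "max_jordan_block M =
     Max {m. \<exists>nas z. jordan_nf (cmat_of M) nas \<and> (m, z) \<in> set nas \<and> cmod z = rho M}"

text \<open>
  A tuple \<open>(h\<^sub>1, \<dots>, h\<^sub>s)\<close> indexed by the peripheral eigenvalues \<open>g\<^sub>1\<rho>, \<dots>, g\<^sub>s\<rho>\<close> is represented by a
  function that maps \<open>g\<^sub>m\<rho>\<close> to \<open>h\<^sub>m\<close> and is constantly \<open>1\<close> elsewhere.  The constant coordinates
  are irrelevant for the closure in the product topology of \<open>complex \<Rightarrow> complex\<close>.
\<close>

definition phases :: "complex^'d^'d \<Rightarrow> complex \<Rightarrow> complex" where
  "phases M z = (if z \<in> peripheral M then z / complex_of_real (rho M) else 1)"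

definition phase_group :: "complex^'d^'d \<Rightarrow> (complex \<Rightarrow> complex) set" where
  "phase_group M = closure {\<lambda>z. phases M z ^ n | n. True}"

definition complexify :: "(real^'d) set \<Rightarrow> (complex^'d) set" where
  "complexify V = {x. (\<chi> i. Re (x $ i)) \<in> V \<and> (\<chi> i. Im (x $ i)) \<in> V}"

definition gen_eigenspace :: "complex^'d^'d \<Rightarrow> complex \<Rightarrow> (complex^'d) set" where
  "gen_eigenspace M z = {x. \<exists>n. matpow (M - Finite_Cartesian_Product.mat z) n *v x = 0}"

text \<open>
  The argument \<open>M\<close> leaves the complexification of \<open>V\<close> invariant, so the following conditions
  determine the matrix uniquely.  The generalised eigenspace for \<open>0\<close> has to be intersected with
  \<open>V\<close>, because \<open>M\<close> also vanishes on the orthogonal complement.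
\<close>

definition phase_mat ::
  "(real^'d) set \<Rightarrow> complex^'d^'d \<Rightarrow> (complex \<Rightarrow> complex) \<Rightarrow> complex^'d^'d" where
  "phase_mat V M h =
     (THE R.
        (\<forall>z. \<forall>x \<in> gen_eigenspace M z \<inter> complexify V.
           R *v x = (if z \<in> peripheral M then h z *s x else x)) \<and>
        (\<forall>x \<in> complexify (orthogonal_comp V). R *v x = x))"

definition limit_mat :: "(real^'d) set \<Rightarrow> complex^'d^'d \<Rightarrow> complex^'d^'d" where
  "limit_mat V M =
     (let r = max_jordan_block M;
          R = phase_mat V M (\<lambda>z. inverse (phases M z))
      in lim (\<lambda>n. (fact (r - 1) / (real n ^ (r - 1) * rho M powi (int n - int r + 1)))
                    *\<^sub>R (matpow R n ** matpow M n)))"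

text \<open>
  A positive complex number is one that is real and positive; \<open>scalar_product\<close> is bilinear.
\<close>

definition nondegenerate_rep ::
  "nat \<Rightarrow> real^'d \<Rightarrow> (nat \<Rightarrow> real^'d^'d) \<Rightarrow> real^'d \<Rightarrow> bool" where
  "nondegenerate_rep k u A v \<longleftrightarrow>
     (let V = reach_space k u A;
          M = cmat (restr_mat k u A (total_mat k A))
      in rho M > 0 \<and>
         (\<forall>h \<in> phase_group M. \<exists>t::real. t > 0 \<and>
            scalar_product (cvec u)
              ((cmat (total_mat k A - A 0) ** phase_mat V M h ** limit_mat V M) *v cvec v)
            = complex_of_real t))"

text \<open>
  The type argument carries the degree.  Since a minimal representation has degree
  \<open>dim (kernel_space k f)\<close>, the property can only hold if \<open>CARD('d)\<close> is that dimension, and it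
  does not depend on which index type of this cardinality is taken.
\<close>

definition nondegenerate :: "'d::finite itself \<Rightarrow> nat \<Rightarrow> (nat \<Rightarrow> real) \<Rightarrow> bool" where
  "nondegenerate TYPE('d) k f \<longleftrightarrow>
     (\<exists>(u :: real^'d) A v. minimal_rep k f u A v \<and> nondegenerate_rep k u A v)"

text \<open>
  The torus is the set \<open>{0..<1}\<close>.  Its Borel sets are the Borel subsets of \<open>{0..<1}\<close>, whereas its
  continuous functions are the restrictions of the continuous functions on the line with period
  \<open>1\<close>.
\<close>

definition torus :: "real measure" where
  "torus = restrict_space borel {0..<1}"

definition level_sum :: "nat \<Rightarrow> (nat \<Rightarrow> real) \<Rightarrow> nat \<Rightarrow> real" where
  "level_sum k f N = (\<Sum>m = k ^ N..<k ^ (N + 1). f m)"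

definition level_measure :: "nat \<Rightarrow> (nat \<Rightarrow> real) \<Rightarrow> nat \<Rightarrow> real measure" where
  "level_measure k f N =
     distr
       (point_measure {..<k ^ (N + 1) - k ^ N} (\<lambda>m. ennreal (f (k ^ N + m) / level_sum k f N)))
       torus
       (\<lambda>m. real m / (real k ^ N * (real k - 1)))"

definition weak_limit :: "(nat \<Rightarrow> real measure) \<Rightarrow> real measure \<Rightarrow> bool" where
  "weak_limit Ms M \<longleftrightarrow>
     (\<forall>g :: real \<Rightarrow> real. continuous_on UNIV g \<longrightarrow> (\<forall>x. g (x + 1) = g x) \<longrightarrow>
        (\<lambda>n. LINT x|Ms n. g x) \<longlonglongrightarrow> (LINT x|M. g x))"

definition ghost_measure :: "nat \<Rightarrow> (nat \<Rightarrow> real) \<Rightarrow> real measure \<Rightarrow> bool" where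
  "ghost_measure k f M \<longleftrightarrow>
     prob_space M \<and> sets M = sets torus \<and>
     (\<exists>\<phi> :: nat \<Rightarrow> nat. strict_mono \<phi> \<and> (\<forall>n. level_sum k f (\<phi> n) \<noteq> 0) \<and>
        weak_limit (\<lambda>n. level_measure k f (\<phi> n)) M)"

definition pure_point_part :: "'a measure \<Rightarrow> 'a measure" where
  "pure_point_part M = density M (indicator {x \<in> space M. measure M {x} \<noteq> 0})"

lemma emeasure_pure_point_part:
  assumes "finite_measure M" "\<And>x. x \<in> space M \<Longrightarrow> {x} \<in> sets M" "E \<in> sets M"
  shows "emeasure (pure_point_part M) E = emeasure M (E \<inter> {x \<in> space M. measure M {x} \<noteq> 0})"
proof -
  have "{x \<in> space M. measure M {x} \<noteq> 0} \<subseteq> {x. measure M {x} \<noteq> 0}"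
    by blast
  then have "countable {x \<in> space M. measure M {x} \<noteq> 0}"
    using finite_measure.countable_support[OF assms(1)] by (rule countable_subset)
  then have P: "{x \<in> space M. measure M {x} \<noteq> 0} \<in> sets M"
    by (rule sets.countable[rotated]) (rule assms(2), simp)
  then have "emeasure (pure_point_part M) E =
      (\<integral>\<^sup>+ x. indicator {x \<in> space M. measure M {x} \<noteq> 0} x * indicator E x \<partial>M)"
    unfolding pure_point_part_def using assms(3) by (intro emeasure_density) auto
  also have "\<dots> = (\<integral>\<^sup>+ x. indicator (E \<inter> {x \<in> space M. measure M {x} \<noteq> 0}) x \<partial>M)"
    by (intro nn_integral_cong) (auto simp: indicator_def)
  also have "\<dots> = emeasure M (E \<inter> {x \<in> space M. measure M {x} \<noteq> 0})"
    using sets.Int[OF assms(3) P] by (rule nn_integral_indicator)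
  finally show ?thesis .
qed

end

theory Submission
  imports Defs
begin

text \<open>
  On vectors of kernel sequences, reading a digit acts by the nonnegative matrices \<open>B i\<close> obtained by
  restricting \<open>A i\<close>, so the mass of a cylinder is a nonnegative combination of the components of
  \<open>(\<Sum>i<k. B i)\<^sup>n v\<close>.  If an irrational \<open>x\<close> were an atom of a ghost measure, then almost all of the
  mass of every sufficiently short cylinder around \<open>x\<close> would concentrate at \<open>x\<close>, and this happens at
  some component of the vector.  By the pigeonhole principle the same component serves two prefixes
  of \<open>x\<close> of different lengths.  The digits following these prefixes differ somewhere, so two disjoint
  cylinders both carry almost all of the mass issuing from that component, at times that differ by a
  multiple of some \<open>p\<close>.  But a shift by \<open>p\<close> changes the orbit of \<open>v\<close> only by bounded factors.
\<close>

section \<open>Matrix powers and the entrywise order\<close>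

primrec matrix_power :: "real^'n^'n \<Rightarrow> nat \<Rightarrow> real^'n^'n" where
  "matrix_power M 0 = Finite_Cartesian_Product.mat 1"
| "matrix_power M (Suc n) = matrix_power M n ** M"

lemma matrix_power_add: "matrix_power M (m + n) = matrix_power M m ** matrix_power M n"
  by (induction n) (simp_all add: matrix_mul_assoc)

lemma matrix_mult_sum_left:
  fixes N :: "'a::semiring_1^'n^'n"
  shows "sum f S ** N = (\<Sum>x\<in>S. f x ** N)"
  by (induction S rule: infinite_finite_induct)
    (simp_all add: matrix_matrix_mult_def vec_eq_iff sum.distrib distrib_right)

lemma matrix_mult_sum_right:
  fixes N :: "'a::semiring_1^'n^'n"
  shows "N ** sum f S = (\<Sum>x\<in>S. N ** f x)"
  by (induction S rule: infinite_finite_induct) (simp_all add: matrix_add_ldistrib)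

lemma matrix_vector_mult_sum_left:
  fixes x :: "'a::semiring_1^'n"
  shows "sum f S *v x = (\<Sum>y\<in>S. f y *v x)"
  by (induction S rule: infinite_finite_induct)
    (simp_all add: matrix_vector_mult_add_rdistrib)

lemma mat_1_nonneg: "(Finite_Cartesian_Product.mat 1 :: real^'n^'n) \<ge> 0"
  by (simp add: less_eq_vec_def Finite_Cartesian_Product.mat_def)

lemma matrix_mult_nonneg:
  fixes M N :: "real^'n^'n"
  assumes "M \<ge> 0" "N \<ge> 0"
  shows "M ** N \<ge> 0"
  using assms by (auto simp: less_eq_vec_def matrix_matrix_mult_def intro!: sum_nonneg)

lemma matrix_vector_mult_mono:
  fixes M N :: "real^'n^'n"
  assumes "0 \<le> M" "M \<le> N" "0 \<le> x" "x \<le> y"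
  shows "M *v x \<le> N *v y"
proof -
  have "M $ i $ j * x $ j \<le> N $ i $ j * y $ j" for i j
    using assms by (intro mult_mono) (auto simp: less_eq_vec_def intro: order_trans[of 0 "M $ i $ j"])
  then show ?thesis
    by (auto simp: less_eq_vec_def matrix_vector_mult_def intro!: sum_mono)
qed

lemma matrix_vector_mult_nonneg:
  fixes M :: "real^'n^'n"
  assumes "0 \<le> M" "0 \<le> x"
  shows "0 \<le> M *v x"
  using matrix_vector_mult_mono[of 0 M 0 x] assms by simp

lemma matrix_power_nonneg: "M \<ge> 0 \<Longrightarrow> matrix_power M n \<ge> 0"
  by (induction n) (simp_all add: matrix_mult_nonneg mat_1_nonneg)

section \<open>Comparing the orbit of \<open>v\<close> with its shifts\<close>

text \<open>The factor is the smallest ratio of an entry of \<open>Y\<close> to the entry of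
  \<open>X\<close> over the common support, capped at 1; off the support both entries
  vanish.\<close>

lemma same_support_comparable:
  fixes X Y :: "real^'n^'n"
  assumes "X \<ge> 0" "Y \<ge> 0" "{(i, j). X $ i $ j \<noteq> 0} = {(i, j). Y $ i $ j \<noteq> 0}"
  shows "\<exists>c>0. c *\<^sub>R X \<le> Y"
proof -
  let ?Q = "{Y $ i $ j / X $ i $ j | i j. X $ i $ j \<noteq> 0}"
  have Q: "?Q = (\<lambda>(i, j). Y $ i $ j / X $ i $ j) ` {(i, j). X $ i $ j \<noteq> 0}"
    by auto
  \<comment> \<open>The inserted 1 keeps the minimum defined when \<open>X\<close> is zero.\<close>
  have fin: "finite (insert 1 ?Q)"
    unfolding Q by (intro finite.insertI finite_imageI) simp
  have supp: "X $ i $ j \<noteq> 0 \<longleftrightarrow> Y $ i $ j \<noteq> 0" for i j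
    using assms(3) by (auto simp: set_eq_iff)
  have nn: "0 \<le> X $ i $ j" "0 \<le> Y $ i $ j" for i j
    using assms(1,2) by (simp_all add: less_eq_vec_def)
  have pos: "q > 0" if "q \<in> insert 1 ?Q" for q
    using that supp nn by (auto simp: less_le)
  have "Min (insert 1 ?Q) > 0"
    using Min_in[OF fin] pos by blast
  moreover have "Min (insert 1 ?Q) *\<^sub>R X \<le> Y"
  proof -
    have "Min (insert 1 ?Q) * X $ i $ j \<le> Y $ i $ j" for i j
    proof (cases "X $ i $ j = 0")
      case True
      then show ?thesis using nn by simp
    next
      case False
      then have "Min (insert 1 ?Q) \<le> Y $ i $ j / X $ i $ j"
        by (intro Min_le fin) blast
      then show ?thesis
        using False nn[of i j] by (simp add: pos_le_divide_eq)
    qed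
    then show ?thesis
      by (simp add: less_eq_vec_def)
  qed
  ultimately show ?thesis by blast
qed

text \<open>
  Only finitely many supports are available, so two powers of \<open>M\<close> have the same one.  This replaces
  the asymptotics of the powers of \<open>M\<close>.
\<close>

lemma orbit_comparable:
  fixes M :: "real^'n^'n"
  assumes "M \<ge> 0" "v \<ge> 0"
  shows "\<exists>p c t. p > 0 \<and> 0 < c \<and> (\<forall>n\<ge>t.
    c *\<^sub>R (matrix_power M n *v v) \<le> matrix_power M (n + p) *v v \<and>
    c *\<^sub>R (matrix_power M (n + p) *v v) \<le> matrix_power M n *v v)"
proof -
  define supp where "supp n = {(i, j). matrix_power M n $ i $ j \<noteq> 0}" for n
  have "finite (range supp)"
    by (rule finite_subset[of _ UNIV]) auto
  then have "\<not> inj supp"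
    using finite_imageD[of supp UNIV] by auto
  then obtain t t' where t: "t < t'" "supp t = supp t'"
    unfolding inj_on_def by (metis linorder_neqE_nat)
  let ?X = "matrix_power M t" and ?Y = "matrix_power M t'"
  obtain c1 where c1: "c1 > 0" "c1 *\<^sub>R ?X \<le> ?Y"
    using same_support_comparable[of ?X ?Y] t(2) matrix_power_nonneg[OF assms(1)]
    unfolding supp_def by blast
  obtain c2 where c2: "c2 > 0" "c2 *\<^sub>R ?Y \<le> ?X"
    using same_support_comparable[of ?Y ?X] t(2) matrix_power_nonneg[OF assms(1)]
    unfolding supp_def by metis
  define c where "c = min c1 c2"
  have c: "c > 0" "c *\<^sub>R ?X \<le> ?Y" "c *\<^sub>R ?Y \<le> ?X"
  proof -
    show "c > 0" using c1 c2 by (simp add: c_def)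
    have "c * ?X $ i $ j \<le> c1 * ?X $ i $ j" "c * ?Y $ i $ j \<le> c2 * ?Y $ i $ j" for i j
      using matrix_power_nonneg[OF assms(1), of t] matrix_power_nonneg[OF assms(1), of t']
      by (auto simp: c_def less_eq_vec_def intro!: mult_right_mono)
    then have "c *\<^sub>R ?X \<le> c1 *\<^sub>R ?X" "c *\<^sub>R ?Y \<le> c2 *\<^sub>R ?Y"
      by (simp_all add: less_eq_vec_def)
    then show "c *\<^sub>R ?X \<le> ?Y" "c *\<^sub>R ?Y \<le> ?X"
      using c1(2) c2(2) by (blast intro: order_trans)+
  qed
  have "c *\<^sub>R (matrix_power M n *v v) \<le> matrix_power M (n + (t' - t)) *v v"
       "c *\<^sub>R (matrix_power M (n + (t' - t)) *v v) \<le> matrix_power M n *v v" if "n \<ge> t" for n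
  proof -
    \<comment> \<open>Both orbit vectors are images of the same \<open>?x \<ge> 0\<close>, so the
      comparison of the powers \<open>t\<close> and \<open>t'\<close> carries over to all
      \<open>n \<ge> t\<close>.\<close>
    let ?x = "matrix_power M (n - t) *v v"
    have x: "?x \<ge> 0"
      by (intro matrix_vector_mult_nonneg matrix_power_nonneg assms)
    have 1: "matrix_power M n *v v = ?X *v ?x"
      using matrix_power_add[of M t "n - t"] that by (simp add: matrix_vector_mul_assoc)
    have 2: "matrix_power M (n + (t' - t)) *v v = ?Y *v ?x"
      using matrix_power_add[of M t' "n - t"] that t by (simp add: matrix_vector_mul_assoc add.commute)
    have nn: "0 \<le> c *\<^sub>R ?X" "0 \<le> c *\<^sub>R ?Y"
      using c(1) matrix_power_nonneg[OF assms(1)] by (auto simp: less_eq_vec_def)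
    show "c *\<^sub>R (matrix_power M n *v v) \<le> matrix_power M (n + (t' - t)) *v v"
       "c *\<^sub>R (matrix_power M (n + (t' - t)) *v v) \<le> matrix_power M n *v v"
      unfolding 1 2 scaleR_matrix_vector_assoc
      by (rule matrix_vector_mult_mono; use nn c x in simp)+
  qed
  with t(1) c(1) show ?thesis
    by (intro exI[of _ "t' - t"] exI[of _ c] exI[of _ t]) auto
qed

section \<open>Products along digit words\<close>

text \<open>
  The digits of \<open>r\<close> are padded with zeros on the left to a word of length \<open>l\<close>.
\<close>

primrec word_prod :: "nat \<Rightarrow> (nat \<Rightarrow> real^'n^'n) \<Rightarrow> nat \<Rightarrow> nat \<Rightarrow> real^'n^'n" where
  "word_prod k B 0 r = Finite_Cartesian_Product.mat 1"
| "word_prod k B (Suc l) r = word_prod k B l (r div k) ** B (r mod k)"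

lemma word_prod_nonneg:
  assumes "k > 0" "\<And>i. i < k \<Longrightarrow> B i \<ge> 0"
  shows "word_prod k B l r \<ge> 0"
  using assms by (induction l arbitrary: r) (auto simp: matrix_mult_nonneg mat_1_nonneg)

text \<open>Distributivity expands the power into one product per word of \<open>l\<close> letters,
  and the numbers below \<open>k ^ l\<close>, padded with zeros, run through each of these words
  once.\<close>

lemma sum_word_prod:
  assumes "k > 0"
  shows "(\<Sum>r<k ^ l. word_prod k B l r) = matrix_power (\<Sum>i<k. B i) l"
proof (induction l)
  case (Suc l)
  \<comment> \<open>Grouping \<open>r = i + q * k\<close> by its quotient \<open>q\<close> splits
    off the last digit \<open>i\<close>.\<close>
  have "(\<Sum>r<k ^ Suc l. word_prod k B (Suc l) r) =
      (\<Sum>q<k ^ l. \<Sum>r\<in>{q * k..<q * k + k}. word_prod k B (Suc l) r)"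
    by (simp add: sum.nat_group mult.commute)
  also have "\<dots> = (\<Sum>q<k ^ l. \<Sum>i<k. word_prod k B l q ** B i)"
  proof (rule sum.cong[OF refl])
    fix q
    have "(\<Sum>r\<in>{q * k..<q * k + k}. word_prod k B (Suc l) r) =
        (\<Sum>i<k. word_prod k B (Suc l) (i + q * k))"
      using sum.shift_bounds_nat_ivl[of "word_prod k B (Suc l)" 0 "q * k" k]
      by (simp add: lessThan_atLeast0 add.commute)
    also have "\<dots> = (\<Sum>i<k. word_prod k B l q ** B i)"
      using assms by (intro sum.cong) auto
    finally show "(\<Sum>r\<in>{q * k..<q * k + k}. word_prod k B (Suc l) r) =
        (\<Sum>i<k. word_prod k B l q ** B i)" .
  qed
  also have "\<dots> = (\<Sum>q<k ^ l. word_prod k B l q) ** (\<Sum>i<k. B i)"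
    by (simp add: matrix_mult_sum_left matrix_mult_sum_right) (rule sum.swap)
  finally show ?case
    by (simp add: Suc.IH)
qed simp

text \<open>Each of the \<open>q\<close> shifts by \<open>p\<close> costs one factor
  \<open>c\<close>. The bounds are componentwise because concentration is compared at a single
  component.\<close>

lemma orbit_comparable_iterated:
  fixes a :: "nat \<Rightarrow> real^'n"
  assumes "0 < c" "\<And>n. n \<ge> t \<Longrightarrow> c *\<^sub>R a n \<le> a (n + p)"
    "\<And>n. n \<ge> t \<Longrightarrow> c *\<^sub>R a (n + p) \<le> a n" "n \<ge> t"
  shows "c ^ q * a n $ j \<le> a (n + p * q) $ j" "c ^ q * a (n + p * q) $ j \<le> a n $ j"
proof (induction q)
  case (Suc q)
  have eq: "n + p * Suc q = n + p * q + p"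
    by simp
  have up: "c * a (n + p * q) $ j \<le> a (n + p * Suc q) $ j"
    using assms(2)[of "n + p * q"] assms(4) unfolding eq by (simp add: less_eq_vec_def)
  have down: "c * a (n + p * Suc q) $ j \<le> a (n + p * q) $ j"
    using assms(3)[of "n + p * q"] assms(4) unfolding eq by (simp add: less_eq_vec_def)
  {
    case 1
    have "c * (c ^ q * a n $ j) \<le> c * a (n + p * q) $ j"
      using Suc.IH(1) assms(1) by simp
    with up show ?case by simp
  next
    case 2
    have "c ^ q * (c * a (n + p * Suc q) $ j) \<le> c ^ q * a (n + p * q) $ j"
      using down assms(1) by (intro mult_left_mono) auto
    with Suc.IH(2) show ?case by (simp add: mult_ac)
  }
qed simp_all

text \<open>The words \<open>s\<close> and \<open>s'\<close> give two different summands of the sum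
  over all words, and the other summands are nonnegative. Hence two distinct words cannot both carry
  nearly all of a positive mass at \<open>j\<close>.\<close>

lemma word_prod_pair_le:
  fixes B :: "nat \<Rightarrow> real^'n^'n"
  assumes k: "k > 0" and B: "\<And>i. i < k \<Longrightarrow> B i \<ge> 0" and x: "x \<ge> 0"
    and s: "s < k ^ l" "s' < k ^ l" "s \<noteq> s'"
  shows "(word_prod k B l s *v x) $ j + (word_prod k B l s' *v x) $ j
      \<le> (matrix_power (\<Sum>i<k. B i) l *v x) $ j"
proof -
  have W: "word_prod k B l r \<ge> 0" for r
    using k B by (rule word_prod_nonneg)
  have "word_prod k B l s + word_prod k B l s' = (\<Sum>r\<in>{s, s'}. word_prod k B l r)"
    using s(3) by simp
  also have "\<dots> \<le> (\<Sum>r<k ^ l. word_prod k B l r)"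
  proof -
    have "(\<Sum>r\<in>{s, s'}. word_prod k B l r $ i $ j) \<le> (\<Sum>r<k ^ l. word_prod k B l r $ i $ j)" for i j
      using s W by (intro sum_mono2) (auto simp: less_eq_vec_def)
    then show ?thesis
      by (simp add: less_eq_vec_def sum_component)
  qed
  also have "\<dots> = matrix_power (\<Sum>i<k. B i) l"
    by (rule sum_word_prod[OF k])
  finally have "word_prod k B l s + word_prod k B l s' \<le> matrix_power (\<Sum>i<k. B i) l" .
  moreover have "0 \<le> word_prod k B l s + word_prod k B l s'"
    using W[of s] W[of s'] by (simp add: less_eq_vec_def)
  ultimately have "(word_prod k B l s + word_prod k B l s') *v x
      \<le> matrix_power (\<Sum>i<k. B i) l *v x"
    using x by (intro matrix_vector_mult_mono) auto
  then show ?thesis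
    by (simp add: less_eq_vec_def matrix_vector_mult_add_rdistrib)
qed

text \<open>If \<open>s\<close> and \<open>s'\<close> differed, moving the concentration of
  \<open>s'\<close> from time \<open>m\<close> to time \<open>m + p * q\<close> would cost
  \<open>c ^ q\<close> at each end of the word and leave \<open>s'\<close> a share of at least
  \<open>\<delta> * \<theta>\<close>. With the share \<open>\<theta>\<close> of \<open>s\<close>
  this would exceed the whole. The bound \<open>q \<le> d\<close> lets one \<open>\<theta>\<close>
  serve all times, word lengths and components.\<close>

lemma concentrated_words_agree:
  fixes B :: "nat \<Rightarrow> real^'n^'n"
  assumes k: "k > 0" and B: "\<And>i. i < k \<Longrightarrow> B i \<ge> 0" and v: "v \<ge> 0"
  defines "a \<equiv> \<lambda>n. matrix_power (\<Sum>i<k. B i) n *v v"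
  shows "\<exists>p t \<theta>. p > 0 \<and> 0 < \<theta> \<and> \<theta> < 1 \<and> (\<forall>j l q m s s'.
    q \<le> d \<longrightarrow> t \<le> m \<longrightarrow> s < k ^ l \<longrightarrow> s' < k ^ l \<longrightarrow> 0 < a (m + p * q + l) $ j \<longrightarrow>
    \<theta> * a (m + p * q + l) $ j \<le> (word_prod k B l s *v a (m + p * q)) $ j \<longrightarrow>
    \<theta> * a (m + l) $ j \<le> (word_prod k B l s' *v a m) $ j \<longrightarrow> s = s')"
proof -
  have sum0: "(\<Sum>i<k. B i) \<ge> 0"
    using B by (auto simp: less_eq_vec_def sum_component intro!: sum_nonneg)
  have a0: "a n \<ge> 0" for n
    unfolding a_def by (intro matrix_vector_mult_nonneg matrix_power_nonneg sum0 v)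
  obtain p c0 t where p: "p > 0" and c0: "0 < c0"
    "\<And>n. n \<ge> t \<Longrightarrow> c0 *\<^sub>R a n \<le> a (n + p)" "\<And>n. n \<ge> t \<Longrightarrow> c0 *\<^sub>R a (n + p) \<le> a n"
    using orbit_comparable[OF sum0 v] unfolding a_def by blast
  \<comment> \<open>With \<open>c \<le> 1\<close> the powers of \<open>c\<close> decrease, so
    \<open>c ^ (2 * d)\<close> bounds \<open>c ^ (2 * q)\<close> from below for every
    \<open>q \<le> d\<close>.\<close>
  define c where "c = min c0 1"
  have shrink: "c *\<^sub>R x \<le> y" if "x \<ge> 0" "c0 *\<^sub>R x \<le> y" for x y :: "real^'n"
  proof -
    have "c *\<^sub>R x \<le> c0 *\<^sub>R x"
      using that(1) by (auto simp: c_def less_eq_vec_def intro!: mult_right_mono)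
    with that(2) show ?thesis by (rule order_trans[rotated])
  qed
  have c: "0 < c" "\<And>n. n \<ge> t \<Longrightarrow> c *\<^sub>R a n \<le> a (n + p)"
      "\<And>n. n \<ge> t \<Longrightarrow> c *\<^sub>R a (n + p) \<le> a n" and "c \<le> 1"
    using c0 a0 by (simp_all add: shrink) (simp_all add: c_def)
  define \<delta> where "\<delta> = c ^ (2 * d)"
  \<comment> \<open>Any \<open>\<theta> < 1\<close> with
    \<open>\<theta> * (1 + \<delta>) > 1\<close> would do.\<close>
  define \<theta> where "\<theta> = 1 / (1 + \<delta> / 2)"
  have \<delta>: "\<delta> > 0"
    using c(1) by (simp add: \<delta>_def)
  have "\<theta> + \<delta> * \<theta> = (1 + \<delta>) / (1 + \<delta> / 2)"
    by (simp add: \<theta>_def add_divide_distrib)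
  with \<delta> have \<theta>: "0 < \<theta>" "\<theta> < 1" "\<theta> + \<delta> * \<theta> > 1"
    by (simp_all add: \<theta>_def less_divide_eq divide_less_eq)
  have "s = s'"
    if q: "q \<le> d" and m: "t \<le> m" and s: "s < k ^ l" "s' < k ^ l"
      and pos: "0 < a (m + p * q + l) $ j"
      and W: "\<theta> * a (m + p * q + l) $ j \<le> (word_prod k B l s *v a (m + p * q)) $ j"
      and W': "\<theta> * a (m + l) $ j \<le> (word_prod k B l s' *v a m) $ j"
    for j l q m s s'
  proof (rule ccontr)
    assume ne: "s \<noteq> s'"
    have "m + l \<ge> t"
      using m by simp
    note it = orbit_comparable_iterated[where a = a and p = p, OF c m, of q]
      orbit_comparable_iterated[where a = a and p = p, OF c \<open>m + l \<ge> t\<close>, of q]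
    have eq: "m + l + p * q = m + p * q + l"
      by simp
    have "c ^ (2 * d) \<le> c ^ (2 * q)"
      using q c(1) \<open>c \<le> 1\<close> by (intro power_decreasing) auto
    \<comment> \<open>One factor \<open>c ^ q\<close> moves the total from
      \<open>m + p * q + l\<close> back to \<open>m + l\<close>, the other moves the vector from
      \<open>m\<close> forward to \<open>m + p * q\<close>.\<close>
    then have "\<delta> * \<theta> * a (m + p * q + l) $ j \<le> c ^ (2 * q) * \<theta> * a (m + p * q + l) $ j"
      using pos \<theta>(1) by (intro mult_right_mono) (auto simp: \<delta>_def)
    also have "\<dots> = c ^ q * (\<theta> * (c ^ q * a (m + p * q + l) $ j))"
      by (simp only: mult_2 power_add) (simp add: mult_ac)
    also have "\<dots> \<le> c ^ q * (\<theta> * a (m + l) $ j)"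
      using it(4)[of j] c(1) \<theta>(1) unfolding eq by (intro mult_left_mono) auto
    also have "\<dots> \<le> c ^ q * (word_prod k B l s' *v a m) $ j"
      using W' c(1) by (intro mult_left_mono) auto
    also have "\<dots> = (word_prod k B l s' *v (c ^ q *\<^sub>R a m)) $ j"
      by (simp add: matrix_vector_mult_scaleR)
    also have "\<dots> \<le> (word_prod k B l s' *v a (m + p * q)) $ j"
    proof -
      have "word_prod k B l s' *v (c ^ q *\<^sub>R a m) \<le> word_prod k B l s' *v a (m + p * q)"
      proof (rule matrix_vector_mult_mono)
        show "0 \<le> c ^ q *\<^sub>R a m"
          using a0[of m] c(1) by (simp add: less_eq_vec_def)
      qed (use it(1) word_prod_nonneg[OF k B] in \<open>auto simp: less_eq_vec_def\<close>)
      then show ?thesis by (simp add: less_eq_vec_def)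
    qed
    finally have "(\<theta> + \<delta> * \<theta>) * a (m + p * q + l) $ j
        \<le> (word_prod k B l s *v a (m + p * q)) $ j + (word_prod k B l s' *v a (m + p * q)) $ j"
      using W by (simp add: algebra_simps)
    also have "\<dots> \<le> (matrix_power (\<Sum>i<k. B i) l *v a (m + p * q)) $ j"
      by (rule word_prod_pair_le[OF k B a0 s ne])
    also have "\<dots> = 1 * a (m + p * q + l) $ j"
      using matrix_power_add[of "\<Sum>i<k. B i" l "m + p * q"]
      by (simp add: a_def matrix_vector_mul_assoc add.commute)
    finally show False
      using pos \<theta>(3) by (simp add: mult_le_cancel_right)
  qed
  with p \<theta>(1,2) show ?thesis
    by (intro exI[of _ p] exI[of _ t] exI[of _ \<theta>]) blast
qed

section \<open>Block sums and prefix vectors\<close>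

text \<open>If \<open>n\<close> has \<open>L + 1\<close> digits, this is the mass, before
  normalisation, that the level \<open>L + l\<close> gives to the cylinder of the prefix
  \<open>n\<close>.\<close>

definition block_sum :: "nat \<Rightarrow> (nat \<Rightarrow> real) \<Rightarrow> nat \<Rightarrow> nat \<Rightarrow> real" where
  "block_sum k f n l = (\<Sum>r<k ^ l. f (k ^ l * n + r))"

text \<open>Digits are appended one at a time. Prefixes start at 1 because in the application
  \<open>B\<close> consists of the restricted matrices and \<open>w 0 = u\<close> may lie outside
  the reach space.\<close>

lemma prefix_vector_word_prod:
  assumes w: "\<And>n i. n \<ge> 1 \<Longrightarrow> i < k \<Longrightarrow> w (k * n + i) = w n v* B i"
    and n: "n \<ge> 1" and r: "r < k ^ l"
  shows "w (k ^ l * n + r) = w n v* word_prod k B l r"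
  using r
proof (induction l arbitrary: r)
  case (Suc l)
  then have k: "k > 0"
    by (cases "k = 0") auto
  have "r div k < k ^ l"
    using Suc.prems k by (simp add: less_mult_imp_div_less mult.commute)
  have "k ^ Suc l * n + r = k * (k ^ l * n + r div k) + r mod k"
    by (simp add: algebra_simps)
  moreover have "w (k * (k ^ l * n + r div k) + r mod k) = w (k ^ l * n + r div k) v* B (r mod k)"
    using n k by (intro w) (auto simp: Suc_le_eq)
  ultimately show ?case
    using Suc.IH[OF \<open>r div k < k ^ l\<close>] by (simp add: vector_matrix_mul_assoc)
qed simp

text \<open>The prefix enters only through the row vector \<open>w n\<close>, the remaining digits
  only through the orbit of \<open>v\<close>. Thus cylinders with equally many digits left share one
  orbit vector.\<close>

lemma block_sum_eq:
  assumes k: "k > 0" and w: "\<And>n i. n \<ge> 1 \<Longrightarrow> i < k \<Longrightarrow> w (k * n + i) = w n v* B i"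
    and f: "\<And>n. n \<ge> 1 \<Longrightarrow> f n = inner (w n) v" and n: "n \<ge> 1"
  shows "block_sum k f n l = inner (w n) (matrix_power (\<Sum>i<k. B i) l *v v)"
proof -
  have "f (k ^ l * n + r) = inner (w n) (word_prod k B l r *v v)" if "r < k ^ l" for r
    using f[of "k ^ l * n + r"] prefix_vector_word_prod[OF w n that] n k
    by (simp add: dot_lmul_matrix Suc_le_eq)
  then have "block_sum k f n l = (\<Sum>r<k ^ l. inner (w n) (word_prod k B l r *v v))"
    by (simp add: block_sum_def)
  also have "\<dots> = inner (w n) ((\<Sum>r<k ^ l. word_prod k B l r) *v v)"
    by (simp add: inner_sum_right matrix_vector_mult_sum_left)
  finally show ?thesis
    by (simp add: sum_word_prod[OF k])
qed

section \<open>Digit prefixes of real numbers\<close>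

text \<open>For \<open>1 \<le> y < k\<close> this is the integer written by the first
  \<open>L + 1\<close> base-\<open>k\<close> digits of \<open>y\<close>. A torus point
  \<open>x\<close> enters as \<open>y = 1 + (k - 1) * x\<close>, which makes the leading digit
  nonzero.\<close>

definition digit_prefix :: "nat \<Rightarrow> real \<Rightarrow> nat \<Rightarrow> nat" where
  "digit_prefix k y L = nat \<lfloor>real k ^ L * y\<rfloor>"

lemma digit_prefix_bounds:
  assumes "y \<ge> 0"
  shows "real (digit_prefix k y L) \<le> real k ^ L * y" "real k ^ L * y < real (digit_prefix k y L) + 1"
proof -
  have "0 \<le> real k ^ L * y"
    using assms by simp
  then show "real (digit_prefix k y L) \<le> real k ^ L * y" "real k ^ L * y < real (digit_prefix k y L) + 1"
    unfolding digit_prefix_def by (linarith, linarith)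
qed

lemma digit_prefix_eqI:
  assumes "real n \<le> real k ^ L * y" "real k ^ L * y < real n + 1"
  shows "digit_prefix k y L = n"
  unfolding digit_prefix_def using assms by linarith

lemma digit_prefix_div:
  assumes "k > 0" "y \<ge> 0"
  shows "digit_prefix k y (L + l) div k ^ l = digit_prefix k y L"
proof -
  have "\<lfloor>real k ^ L * y\<rfloor> = \<lfloor>real k ^ (L + l) * y / real_of_int (int (k ^ l))\<rfloor>"
    using assms(1) by (simp add: power_add)
  also have "\<dots> = \<lfloor>real k ^ (L + l) * y\<rfloor> div int (k ^ l)"
    by (rule floor_divide_real_eq_div) simp
  finally show ?thesis
    unfolding digit_prefix_def using assms by (simp add: nat_div_distrib nat_power_eq)
qed

text \<open>Up to an error of at most 1, the word is \<open>k ^ l\<close> times the fractional part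
  of \<open>k ^ L * y\<close>. For irrational \<open>y\<close> the fractional parts for
  \<open>L\<close> and \<open>L'\<close> differ, so their multiples by \<open>k ^ l\<close>
  eventually lie more than 2 apart.\<close>

lemma eventually_digit_words_distinct:
  assumes k: "k \<ge> 2" and y: "y \<ge> 0" "y \<notin> \<rat>" and L: "L \<noteq> L'"
  shows "\<forall>\<^sub>F l in sequentially.
    digit_prefix k y (L + l) mod k ^ l \<noteq> digit_prefix k y (L' + l) mod k ^ l"
proof -
  define e where "e L = real k ^ L * y - real (digit_prefix k y L)" for L
  have "e L \<noteq> e L'"
  proof
    \<comment> \<open>Equal fractional parts give a linear equation for \<open>y\<close> with
      integer coefficients and nonzero leading one.\<close>
    assume "e L = e L'"
    then have "(real k ^ L - real k ^ L') * y = real (digit_prefix k y L) - real (digit_prefix k y L')"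
      by (simp add: e_def algebra_simps)
    moreover have "real k ^ L \<noteq> real k ^ L'"
      using k L by (simp add: power_inject_exp)
    ultimately have "y = (real (digit_prefix k y L) - real (digit_prefix k y L')) /
        (real k ^ L - real k ^ L')"
      by (simp add: field_simps)
    also have "\<dots> \<in> \<rat>"
      by (intro Rats_divide Rats_diff Rats_power Rats_of_nat)
    finally show False
      using y(2) by simp
  qed
  have approx: "\<bar>real (digit_prefix k y (L + l) mod k ^ l) - real k ^ l * e L\<bar> \<le> 1" for L l
  proof -
    have "digit_prefix k y (L + l) = k ^ l * digit_prefix k y L + digit_prefix k y (L + l) mod k ^ l"
      using digit_prefix_div[of k y L l] k y(1)
      by (metis mult_div_mod_eq less_le_trans pos2)
    then have "real (digit_prefix k y (L + l)) =
        real k ^ l * real (digit_prefix k y L) + real (digit_prefix k y (L + l) mod k ^ l)"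
      by (metis of_nat_add of_nat_mult of_nat_power)
    then show ?thesis
      using digit_prefix_bounds[OF y(1), of k "L + l"]
      by (simp add: e_def algebra_simps power_add)
  qed
  have "filterlim (\<lambda>l. real k ^ l * \<bar>e L - e L'\<bar>) at_top sequentially"
    using k \<open>e L \<noteq> e L'\<close>
    by (intro filterlim_at_top_mult_tendsto_pos[OF tendsto_const]
        filterlim_at_infinity_imp_filterlim_at_top filterlim_realpow_sequentially_gt1) auto
  then have "\<forall>\<^sub>F l in sequentially. 2 < real k ^ l * \<bar>e L - e L'\<bar>"
    by (simp add: filterlim_at_top_dense)
  then show ?thesis
  proof eventually_elim
    case (elim l)
    show ?case
    proof
      assume "digit_prefix k y (L + l) mod k ^ l = digit_prefix k y (L' + l) mod k ^ l"
      then have "\<bar>real k ^ l * e L - real k ^ l * e L'\<bar> \<le> 2"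
        using approx[of L l] approx[of L' l] by linarith
      then show False
        using elim by (simp add: abs_mult flip: right_diff_distrib)
    qed
  qed
qed

section \<open>Concentration of mass forces rationality\<close>

text \<open>Pairing with \<open>w\<close> averages with nonnegative weights: were the ratio below
  \<open>\<theta>\<close> at every component with \<open>a $ j > 0\<close>, it would be below
  \<open>\<theta>\<close> for the pairing.\<close>

lemma ratio_attained_at_component:
  fixes w a b :: "real^'n"
  assumes nn: "w \<ge> 0" "a \<ge> 0" "b \<le> a" and pos: "0 < inner w a"
    and le: "\<theta> * inner w a \<le> inner w b"
  shows "\<exists>j. 0 < a $ j \<and> \<theta> * a $ j \<le> b $ j"
proof (rule ccontr)
  assume neg: "\<not> ?thesis"
  have "w $ j * b $ j \<le> \<theta> * (w $ j * a $ j)" for j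
  proof (cases "a $ j = 0")
    \<comment> \<open>Here \<open>b \<le> a\<close> forces \<open>b $ j \<le> 0\<close>, so this
      component cannot raise the pairing with \<open>b\<close>.\<close>
    case True
    with nn show ?thesis
      by (auto simp: less_eq_vec_def intro: mult_nonneg_nonpos) (metis mult_nonneg_nonpos)
  next
    case False
    with nn neg have "b $ j \<le> \<theta> * a $ j"
      by (force simp: less_eq_vec_def less_le)
    then have "w $ j * b $ j \<le> w $ j * (\<theta> * a $ j)"
      using nn by (intro mult_left_mono) (auto simp: less_eq_vec_def)
    then show ?thesis by (simp add: mult_ac)
  qed
  \<comment> \<open>Positivity of the pairing with \<open>a\<close> supplies a component where
    weight and entry are positive and the inequality is strict.\<close>
  moreover have "\<exists>j. w $ j * b $ j < \<theta> * (w $ j * a $ j)"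
  proof -
    obtain j where j: "w $ j * a $ j \<noteq> 0"
      using pos by (auto simp: inner_vec_def elim: sum.not_neutral_contains_not_neutral[rotated])
        (metis (mono_tags, lifting) less_irrefl sum.neutral mult_eq_0_iff)
    with nn have "w $ j > 0" "a $ j > 0"
      by (auto simp: less_eq_vec_def less_le)
    with neg have "b $ j < \<theta> * a $ j"
      by force
    with \<open>w $ j > 0\<close> have "w $ j * b $ j < w $ j * (\<theta> * a $ j)"
      by (rule mult_strict_left_mono[rotated])
    then show ?thesis by (auto simp: mult_ac)
  qed
  ultimately have "(\<Sum>j\<in>UNIV. w $ j * b $ j) < (\<Sum>j\<in>UNIV. \<theta> * (w $ j * a $ j))"
    by (intro sum_strict_mono_ex1) auto
  with le show False
    by (simp add: inner_vec_def sum_distrib_left)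
qed

lemma word_prod_orbit_le:
  fixes B :: "nat \<Rightarrow> real^'n^'n"
  assumes k: "k > 0" and B: "\<And>i. i < k \<Longrightarrow> B i \<ge> 0" and x: "x \<ge> 0" and s: "s < k ^ l"
  shows "word_prod k B l s *v x \<le> matrix_power (\<Sum>i<k. B i) l *v x"
proof -
  have W: "word_prod k B l r \<ge> 0" for r
    using k B by (rule word_prod_nonneg)
  have "word_prod k B l s $ i $ j \<le> (\<Sum>r<k ^ l. word_prod k B l r $ i $ j)" for i j
    using s W by (intro member_le_sum) (auto simp: less_eq_vec_def)
  then have "word_prod k B l s \<le> (\<Sum>r<k ^ l. word_prod k B l r)"
    by (simp add: less_eq_vec_def sum_component)
  then show ?thesis
    using W x by (simp add: sum_word_prod[OF k] matrix_vector_mult_mono)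
qed

text \<open>
  Among the prefixes of lengths \<open>L0, L0 + p, L0 + 2 p, \<dots>\<close>, two concentrate at the same component
  \<open>j\<close>, so their continuations agree.  Distinct tails of an irrational number do not.
\<close>

lemma concentration_imp_rational:
  fixes B :: "nat \<Rightarrow> real^'n^'n"
  assumes k: "k \<ge> 2" and B: "\<And>i. i < k \<Longrightarrow> B i \<ge> 0" and v: "v \<ge> 0"
    and w0: "\<And>n. n \<ge> 1 \<Longrightarrow> w n \<ge> 0"
    and w: "\<And>n i. n \<ge> 1 \<Longrightarrow> i < k \<Longrightarrow> w (k * n + i) = w n v* B i"
    and f: "\<And>n. n \<ge> 1 \<Longrightarrow> f n = inner (w n) v"
    and y: "y \<ge> 1" and \<phi>: "filterlim \<phi> at_top sequentially"
    and conc: "\<And>\<theta>. 0 < \<theta> \<Longrightarrow> \<theta> < 1 \<Longrightarrow> \<exists>L0. \<forall>L\<ge>L0. \<forall>l. \<forall>\<^sub>F n in sequentially.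
      0 < block_sum k f (digit_prefix k y L) (\<phi> n - L) \<and>
      \<theta> * block_sum k f (digit_prefix k y L) (\<phi> n - L)
        \<le> block_sum k f (digit_prefix k y (L + l)) (\<phi> n - (L + l))"
  shows "y \<in> \<rat>"
proof (rule ccontr)
  assume irr: "y \<notin> \<rat>"
  have k0: "k > 0" using k by simp
  have y0: "y \<ge> 0" using y by simp
  \<comment> \<open>The \<open>d + 1\<close> prefix lengths \<open>L 0, ..., L d\<close> face only
    \<open>d\<close> components, and two of their indices differ by at most \<open>d\<close>, the
    bound on \<open>q\<close> in \<open>agree\<close>.\<close>
  define d where "d = CARD('n)"
  define a where "a n = matrix_power (\<Sum>i<k. B i) n *v v" for n
  have sum0: "(\<Sum>i<k. B i) \<ge> 0"
    using B by (auto simp: less_eq_vec_def sum_component intro!: sum_nonneg)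
  have a0: "a n \<ge> 0" for n
    unfolding a_def by (intro matrix_vector_mult_nonneg matrix_power_nonneg sum0 v)
  obtain p t \<theta> where p: "p > 0" and \<theta>: "0 < \<theta>" "\<theta> < 1" and agree:
    "\<And>j l q m s s'. q \<le> d \<Longrightarrow> t \<le> m \<Longrightarrow> s < k ^ l \<Longrightarrow> s' < k ^ l \<Longrightarrow>
      0 < a (m + p * q + l) $ j \<Longrightarrow>
      \<theta> * a (m + p * q + l) $ j \<le> (word_prod k B l s *v a (m + p * q)) $ j \<Longrightarrow>
      \<theta> * a (m + l) $ j \<le> (word_prod k B l s' *v a m) $ j \<Longrightarrow> s = s'"
    using concentrated_words_agree[where k = k and B = B and v = v and d = d, OF k0 B v]
    unfolding a_def by metis
  obtain L0 where L0: "\<And>L l. L \<ge> L0 \<Longrightarrow> \<forall>\<^sub>F n in sequentially.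
      0 < block_sum k f (digit_prefix k y L) (\<phi> n - L) \<and>
      \<theta> * block_sum k f (digit_prefix k y L) (\<phi> n - L)
        \<le> block_sum k f (digit_prefix k y (L + l)) (\<phi> n - (L + l))"
    using conc[OF \<theta>] by blast
  \<comment> \<open>The spacing \<open>p\<close> makes the numbers of digits left after two prefixes
    differ by a multiple of \<open>p\<close>.\<close>
  define L where "L i = L0 + p * i" for i
  define s where "s l i = digit_prefix k y (L i + l) mod k ^ l" for l i
  have s: "s l i < k ^ l" for l i
    using k0 by (simp add: s_def)
  \<comment> \<open>A single \<open>l\<close> has to separate all continuations at once; they are
    finitely many.\<close>
  have "\<forall>\<^sub>F l in sequentially. \<forall>i\<in>{..d}. \<forall>i'\<in>{..d}. i \<noteq> i' \<longrightarrow> s l i \<noteq> s l i'"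
  proof (intro eventually_ball_finite ballI finite_atMost)
    fix i i'
    show "\<forall>\<^sub>F l in sequentially. i \<noteq> i' \<longrightarrow> s l i \<noteq> s l i'"
      using eventually_digit_words_distinct[OF k y0 irr, of "L i" "L i'"] p
      by (cases "i = i'") (auto simp: s_def L_def)
  qed
  then obtain l where l: "\<And>i i'. i \<le> d \<Longrightarrow> i' \<le> d \<Longrightarrow> i \<noteq> i' \<Longrightarrow> s l i \<noteq> s l i'"
    unfolding eventually_sequentially by (metis atMost_iff order_refl)
  \<comment> \<open>One level \<open>N\<close> is fixed at which all concentration statements hold
    and at least \<open>t\<close> digits remain behind each word.\<close>
  have "\<forall>\<^sub>F n in sequentially. L d + l + t \<le> \<phi> n"
    using \<phi> by (simp add: filterlim_at_top)
  moreover have "\<forall>\<^sub>F n in sequentially. \<forall>i\<in>{..d}.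
      0 < block_sum k f (digit_prefix k y (L i)) (\<phi> n - L i) \<and>
      \<theta> * block_sum k f (digit_prefix k y (L i)) (\<phi> n - L i)
        \<le> block_sum k f (digit_prefix k y (L i + l)) (\<phi> n - (L i + l))"
    by (intro eventually_ball_finite ballI finite_atMost L0) (simp add: L_def)
  ultimately have "\<forall>\<^sub>F n in sequentially. L d + l + t \<le> \<phi> n \<and> (\<forall>i\<in>{..d}.
      0 < block_sum k f (digit_prefix k y (L i)) (\<phi> n - L i) \<and>
      \<theta> * block_sum k f (digit_prefix k y (L i)) (\<phi> n - L i)
        \<le> block_sum k f (digit_prefix k y (L i + l)) (\<phi> n - (L i + l)))"
    by (rule eventually_conj)
  then obtain N where N: "L d + l + t \<le> N" and blocks: "\<And>i. i \<le> d \<Longrightarrow>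
      0 < block_sum k f (digit_prefix k y (L i)) (N - L i)" "\<And>i. i \<le> d \<Longrightarrow>
      \<theta> * block_sum k f (digit_prefix k y (L i)) (N - L i)
        \<le> block_sum k f (digit_prefix k y (L i + l)) (N - (L i + l))"
    unfolding eventually_sequentially by (metis atMost_iff order_refl)
  have Ld: "L i \<le> L d" if "i \<le> d" for i
    using that by (simp add: L_def)
  \<comment> \<open>The continuation has the share \<open>\<theta>\<close> in the pairing with the
    prefix vector, hence at some component of the orbit vector.\<close>
  have "\<exists>j. 0 < a (N - L i) $ j \<and>
      \<theta> * a (N - L i) $ j \<le> (word_prod k B l (s l i) *v a (N - (L i + l))) $ j" if i: "i \<le> d" for i
  proof (rule ratio_attained_at_component)
    let ?n = "digit_prefix k y (L i)"
    have n: "?n \<ge> 1"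
    proof -
      have "1 \<le> real k ^ L i * y"
        using mult_mono[of 1 "real k ^ L i" 1 y] k y by simp
      then show ?thesis
        unfolding digit_prefix_def by linarith
    qed
    have n': "digit_prefix k y (L i + l) = k ^ l * ?n + s l i"
      using digit_prefix_div[OF k0 y0, of "L i" l] unfolding s_def by (metis mult_div_mod_eq)
    have eq: "N - L i = l + (N - (L i + l))"
      using N Ld[OF i] by simp
    have a_eq: "a (N - L i) = matrix_power (\<Sum>i<k. B i) l *v a (N - (L i + l))"
      unfolding a_def eq matrix_power_add by (simp add: matrix_vector_mul_assoc)
    show "word_prod k B l (s l i) *v a (N - (L i + l)) \<le> a (N - L i)"
      unfolding a_eq by (rule word_prod_orbit_le[OF k0 B a0 s])
    have 1: "block_sum k f ?n (N - L i) = inner (w ?n) (a (N - L i))"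
      unfolding a_def by (rule block_sum_eq[where w = w, OF k0 w f n])
    have "k ^ l * ?n + s l i \<ge> 1"
      using n k0 by (simp add: Suc_le_eq)
    from block_sum_eq[where w = w, OF k0 w f this]
    have 2: "block_sum k f (digit_prefix k y (L i + l)) (N - (L i + l)) =
        inner (w ?n) (word_prod k B l (s l i) *v a (N - (L i + l)))"
      unfolding n' a_def
      by (simp add: prefix_vector_word_prod[where w = w, OF w n s] dot_lmul_matrix)
    show "0 < inner (w ?n) (a (N - L i))"
      using blocks(1)[OF i] by (simp add: 1)
    show "\<theta> * inner (w ?n) (a (N - L i))
        \<le> inner (w ?n) (word_prod k B l (s l i) *v a (N - (L i + l)))"
      using blocks(2)[OF i] by (simp add: 1 2)
    show "w ?n \<ge> 0"
      by (rule w0[OF n])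
  qed (rule a0)
  then obtain j where j: "\<And>i. i \<le> d \<Longrightarrow> 0 < a (N - L i) $ j i"
      "\<And>i. i \<le> d \<Longrightarrow> \<theta> * a (N - L i) $ j i \<le>
        (word_prod k B l (s l i) *v a (N - (L i + l))) $ j i"
    by metis
  have "\<not> inj_on j {..d}"
  proof
    assume "inj_on j {..d}"
    then have "card {..d} \<le> CARD('n)"
      by (rule card_inj_on_le) auto
    then show False
      by (simp add: d_def)
  qed
  then obtain i i' where i: "i < i'" "i' \<le> d" "j i = j i'"
    unfolding inj_on_def by (metis atMost_iff linorder_neqE_nat)
  \<comment> \<open>\<open>m\<close> counts the digits left after the longer prefix and its word;
    after the shorter prefix and its word there are \<open>p * (i' - i)\<close> more, as
    \<open>agree\<close> requires.\<close>
  define m where "m = N - (L i' + l)"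
  have "L i' = L i + p * (i' - i)"
    using i by (simp add: L_def algebra_simps flip: distrib_left)
  then have m: "t \<le> m" "m + l = N - L i'" "m + p * (i' - i) = N - (L i + l)"
      "m + p * (i' - i) + l = N - L i"
    using N Ld[OF i(2)] by (simp_all add: m_def)
  have "i' - i \<le> d"
    using i(2) by simp
  then have "s l i = s l i'"
    by (rule agree[of "i' - i" m _ l _ "j i"])
      (use j(1)[of i] j(2)[of i] j(2)[of i'] i m s in \<open>auto simp: m_def\<close>)
  with l[of i i'] i show False
    by simp
qed

section \<open>Level measures and cylinders\<close>

text \<open>This is the position of the point mass that \<open>level_measure k f N\<close> attaches
  to \<open>n\<close>: for \<open>n = k ^ N + m\<close> it equals
  \<open>m / (k ^ N * (k - 1))\<close>. Indexing by \<open>n\<close> matches the block sums.\<close>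

definition level_point :: "nat \<Rightarrow> nat \<Rightarrow> nat \<Rightarrow> real" where
  "level_point k N n = (real n / real k ^ N - 1) / (real k - 1)"

lemma level_point_scaled:
  assumes "k \<ge> 2"
  shows "1 + (real k - 1) * level_point k N n = real n / real k ^ N"
  using assms by (simp add: level_point_def)

lemma level_point_in_unit:
  assumes "k \<ge> 2" "n \<in> {k ^ N..<k ^ (N + 1)}"
  shows "level_point k N n \<in> {0..<1}"
proof -
  have "real (k ^ N) \<le> real n" "real n < real (k ^ (N + 1))"
    using assms(2) by (auto simp only: of_nat_le_iff of_nat_less_iff atLeastLessThan_iff)
  then have "1 \<le> real n / real k ^ N" "real n / real k ^ N < real k"
    using assms(1) by (simp_all add: field_simps)
  then show ?thesis
    using assms(1) by (simp add: level_point_def field_simps)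
qed

lemma level_sum_pos:
  assumes "\<And>n. f n \<ge> 0" "level_sum k f N \<noteq> 0"
  shows "level_sum k f N > 0"
proof -
  have "level_sum k f N \<ge> 0"
    unfolding level_sum_def by (intro sum_nonneg assms(1))
  with assms(2) show ?thesis by simp
qed

lemma integral_level_measure:
  assumes k: "k \<ge> 2" and f: "\<And>n. f n \<ge> 0" and pos: "level_sum k f N > 0"
    and g: "g \<in> borel_measurable borel"
  shows "(LINT x|level_measure k f N. g x) =
    (\<Sum>n = k ^ N..<k ^ (N + 1). f n * g (level_point k N n)) / level_sum k f N"
proof -
  let ?D = "{..<k ^ (N + 1) - k ^ N}"
  let ?pt = "\<lambda>m. real m / (real k ^ N * (real k - 1))"
  have le: "k ^ N \<le> k ^ (N + 1)"
    using k by simp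
  have pt: "?pt m = level_point k N (k ^ N + m)" for m
    using k by (simp add: level_point_def add_divide_distrib)
  have "?pt m \<in> {0..<1}" if "m \<in> ?D" for m
    unfolding pt using that by (intro level_point_in_unit k) auto
  \<comment> \<open>All subsets of the source are measurable, so it suffices that the points lie in
    the torus.\<close>
  then have meas: "?pt \<in> point_measure ?D d \<rightarrow>\<^sub>M torus" for d
    unfolding torus_def by (auto simp: measurable_def space_point_measure sets_point_measure space_restrict_space)
  have "g \<in> torus \<rightarrow>\<^sub>M borel"
    unfolding torus_def using g by (rule measurable_restrict_space1)
  then have "(LINT x|level_measure k f N. g x) =
      (LINT m|point_measure ?D (\<lambda>m. ennreal (f (k ^ N + m) / level_sum k f N)). g (?pt m))"
    unfolding level_measure_def by (intro integral_distr meas)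
  also have "\<dots> = (\<Sum>m\<in>?D. f (k ^ N + m) / level_sum k f N * g (?pt m))"
    using f pos by (subst lebesgue_integral_point_measure_finite) auto
  also have "\<dots> = (\<Sum>m\<in>?D. f (k ^ N + m) * g (level_point k N (k ^ N + m))) / level_sum k f N"
    by (simp add: pt sum_divide_distrib)
  also have "(\<Sum>m\<in>?D. f (k ^ N + m) * g (level_point k N (k ^ N + m))) =
      (\<Sum>n = k ^ N..<k ^ (N + 1). f n * g (level_point k N n))"
    using sum.shift_bounds_nat_ivl[of "\<lambda>n. f n * g (level_point k N n)" 0 "k ^ N" "k ^ (N + 1) - k ^ N"] le
    by (simp add: lessThan_atLeast0 add.commute)
  finally show ?thesis .
qed

lemma block_sum_interval: "block_sum k f n l = (\<Sum>m = k ^ l * n..<k ^ l * n + k ^ l. f m)"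
  using sum.shift_bounds_nat_ivl[of f 0 "k ^ l * n" "k ^ l"]
  by (simp add: block_sum_def lessThan_atLeast0 add.commute)

lemma digit_prefix_range:
  assumes "k \<ge> 2" "x \<in> {0..<1}"
  shows "k ^ L \<le> digit_prefix k (1 + (real k - 1) * x) L"
    and "digit_prefix k (1 + (real k - 1) * x) L < k ^ (L + 1)"
proof -
  let ?y = "1 + (real k - 1) * x"
  have "?y < 1 + (real k - 1) * 1"
    using assms by (intro add_strict_left_mono mult_strict_left_mono) auto
  also have "\<dots> = real k"
    by simp
  finally have y: "?y < real k" .
  have y1: "1 \<le> ?y"
    using assms by simp
  then have 1: "real k ^ L * 1 \<le> real k ^ L * ?y" "real k ^ L * ?y < real k ^ L * real k"
    using assms(1) by (intro mult_left_mono mult_strict_left_mono y y1; simp)+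
  note bounds = digit_prefix_bounds[of ?y k L]
  have "real (k ^ L) < real (digit_prefix k ?y L + 1)"
    using 1(1) bounds(2) y1 by simp
  then show "k ^ L \<le> digit_prefix k ?y L"
    unfolding of_nat_less_iff by simp
  have "real (digit_prefix k ?y L) < real k ^ L * real k"
    using 1(2) bounds(1) y1 by linarith
  also have "\<dots> = real (k ^ (L + 1))"
    by simp
  finally show "digit_prefix k ?y L < k ^ (L + 1)"
    unfolding of_nat_less_iff .
qed

lemma prefix_block_subset:
  assumes "k \<ge> 2" "x \<in> {0..<1}" "L \<le> N"
  defines "n \<equiv> digit_prefix k (1 + (real k - 1) * x) L"
  shows "{k ^ (N - L) * n..<k ^ (N - L) * n + k ^ (N - L)} \<subseteq> {k ^ N..<k ^ (N + 1)}"
proof -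
  have n: "k ^ L \<le> n" "n + 1 \<le> k ^ (L + 1)"
    using digit_prefix_range[OF assms(1,2), of L] by (simp_all add: n_def)
  have "k ^ (N - L) * k ^ L \<le> k ^ (N - L) * n" "k ^ (N - L) * (n + 1) \<le> k ^ (N - L) * k ^ (L + 1)"
    using n by (simp_all only: mult_le_mono2)
  moreover have "k ^ (N - L) * k ^ L = k ^ N" "k ^ (N - L) * k ^ (L + 1) = k ^ (N + 1)"
    using assms(3) by (simp_all only: flip: power_add) simp_all
  ultimately have "k ^ N \<le> k ^ (N - L) * n" "k ^ (N - L) * n + k ^ (N - L) \<le> k ^ (N + 1)"
    by (simp_all only: distrib_left mult_1_right)
  then show ?thesis
    by auto
qed

text \<open>Cutting the last \<open>N - L\<close> digits off \<open>m\<close> is division by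
  \<open>k ^ (N - L)\<close>, which also yields the prefix of \<open>m / k ^ N\<close>. This links
  blocks of integers to intervals on the line.\<close>

lemma prefix_block_iff:
  assumes k: "k > 0" and N: "L \<le> N"
  shows "m \<in> {k ^ (N - L) * n..<k ^ (N - L) * n + k ^ (N - L)} \<longleftrightarrow>
    digit_prefix k (real m / real k ^ N) L = n"
proof -
  have "real k ^ N = real k ^ L * real k ^ (N - L)"
    using N by (simp flip: power_add)
  then have "real k ^ L * (real m / real k ^ N) = real m / real (k ^ (N - L))"
    using k by simp
  then have "digit_prefix k (real m / real k ^ N) L = m div k ^ (N - L)"
    unfolding digit_prefix_def by (simp only: floor_divide_of_nat_eq nat_int)
  moreover have "m div k ^ (N - L) = n \<longleftrightarrow>
      k ^ (N - L) * n \<le> m \<and> m < k ^ (N - L) * n + k ^ (N - L)"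
  proof
    assume "m div k ^ (N - L) = n"
    then have "k ^ (N - L) * n + m mod k ^ (N - L) = m"
      using mult_div_mod_eq[of "k ^ (N - L)" m] by simp
    moreover have "m mod k ^ (N - L) < k ^ (N - L)"
      using k by simp
    ultimately show "k ^ (N - L) * n \<le> m \<and> m < k ^ (N - L) * n + k ^ (N - L)"
      by linarith
  qed (auto intro: div_nat_eqI)
  ultimately show ?thesis by auto
qed

text \<open>Points of one cylinder share the integer part of \<open>k ^ L * y\<close>, so they lie
  within \<open>1 / k ^ L\<close> of each other. Dividing by \<open>k - 1 \<ge> 1\<close> keeps this
  bound on the torus, and there \<open>g\<close> is 1.\<close>

lemma block_sum_le_level_integral:
  assumes k: "k \<ge> 2" and f: "\<And>n. f n \<ge> 0" and x: "x \<in> {0..<1}" and N: "L \<le> N"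
    and g0: "\<And>t. g t \<ge> 0" and g1: "\<And>t. \<bar>t - x\<bar> \<le> 1 / real k ^ L \<Longrightarrow> g t = 1"
  shows "block_sum k f (digit_prefix k (1 + (real k - 1) * x) L) (N - L) \<le>
    (\<Sum>n = k ^ N..<k ^ (N + 1). f n * g (level_point k N n))"
proof -
  let ?y = "1 + (real k - 1) * x"
  let ?n = "digit_prefix k ?y L"
  let ?I = "{k ^ (N - L) * ?n..<k ^ (N - L) * ?n + k ^ (N - L)}"
  have y: "?y \<ge> 0"
    using k x by simp
  have "f m = f m * g (level_point k N m)" if m: "m \<in> ?I" for m
  proof -
    let ?z = "real m / real k ^ N"
    have z: "digit_prefix k ?z L = ?n"
      using m prefix_block_iff[of k L N m ?n] k N by simp
    have "\<bar>real k ^ L * ?z - real k ^ L * ?y\<bar> \<le> 1"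
      using digit_prefix_bounds[OF y, of k L] digit_prefix_bounds[of ?z k L] z by simp
    then have "real k ^ L * \<bar>?z - ?y\<bar> \<le> 1"
      by (simp only: abs_mult flip: right_diff_distrib) simp
    moreover have "?z - ?y = (real k - 1) * (level_point k N m - x)"
      using level_point_scaled[OF k, of N m] by (simp add: algebra_simps)
    ultimately have "real k ^ L * ((real k - 1) * \<bar>level_point k N m - x\<bar>) \<le> 1"
      using k by (simp add: abs_mult)
    moreover have "real k ^ L * (1 * \<bar>level_point k N m - x\<bar>) \<le>
        real k ^ L * ((real k - 1) * \<bar>level_point k N m - x\<bar>)"
      using k by (intro mult_left_mono mult_right_mono) auto
    ultimately have "real k ^ L * (1 * \<bar>level_point k N m - x\<bar>) \<le> 1"
      by linarith
    then have "\<bar>level_point k N m - x\<bar> \<le> 1 / real k ^ L"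
      using k by (simp add: pos_le_divide_eq mult.commute)
    then show ?thesis
      by (simp add: g1)
  qed
  then have "block_sum k f ?n (N - L) = (\<Sum>m\<in>?I. f m * g (level_point k N m))"
    unfolding block_sum_interval by (intro sum.cong) auto
  also have "\<dots> \<le> (\<Sum>n = k ^ N..<k ^ (N + 1). f n * g (level_point k N n))"
    by (intro sum_mono2 prefix_block_subset[OF k x N]) (auto simp: f g0)
  finally show ?thesis .
qed

text \<open>Level points outside the cylinder of \<open>x\<close> contribute nothing, and inside it
  \<open>g\<close> is at most 1.\<close>

lemma level_integral_le_block_sum:
  assumes k: "k \<ge> 2" and f: "\<And>n. f n \<ge> 0" and x: "x \<in> {0..<1}" and N: "L \<le> N"
    and g1: "\<And>t. g t \<le> 1"
    and supp: "\<And>t. t \<in> {0..<1} \<Longrightarrow> g t \<noteq> 0 \<Longrightarrow>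
      digit_prefix k (1 + (real k - 1) * t) L = digit_prefix k (1 + (real k - 1) * x) L"
  shows "(\<Sum>n = k ^ N..<k ^ (N + 1). f n * g (level_point k N n)) \<le>
    block_sum k f (digit_prefix k (1 + (real k - 1) * x) L) (N - L)"
proof -
  let ?n = "digit_prefix k (1 + (real k - 1) * x) L"
  let ?I = "{k ^ (N - L) * ?n..<k ^ (N - L) * ?n + k ^ (N - L)}"
  have "(\<Sum>n = k ^ N..<k ^ (N + 1). f n * g (level_point k N n)) =
      (\<Sum>m\<in>?I. f m * g (level_point k N m))"
  proof (rule sum.mono_neutral_right)
    show "\<forall>m\<in>{k ^ N..<k ^ (N + 1)} - ?I. f m * g (level_point k N m) = 0"
    proof
      fix m assume m: "m \<in> {k ^ N..<k ^ (N + 1)} - ?I"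
      then have "digit_prefix k (1 + (real k - 1) * level_point k N m) L \<noteq> ?n"
        unfolding level_point_scaled[OF k]
        using prefix_block_iff[of k L N m ?n] k N by (metis DiffD2 less_le_trans pos2)
      then have "g (level_point k N m) = 0"
        using supp[of "level_point k N m"] level_point_in_unit[OF k, of m N] m by blast
      then show "f m * g (level_point k N m) = 0"
        by simp
    qed
  qed (use prefix_block_subset[OF k x N] in auto)
  also have "\<dots> \<le> (\<Sum>m\<in>?I. f m)"
    by (intro sum_mono) (use f g1 in \<open>auto intro: mult_left_le\<close>)
  finally show ?thesis
    by (simp add: block_sum_interval)
qed

section \<open>Test functions around an irrational point\<close>

text \<open>The ends of the cylinders are multiples of \<open>1 / k ^ L\<close>, hence rational, so
  an irrational \<open>y\<close> lies in the interior of its cylinder.\<close>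

lemma digit_prefix_locally_constant:
  assumes "k > 0" "y \<notin> \<rat>" "y \<ge> 0"
  shows "\<forall>\<^sub>F z in nhds y. digit_prefix k z L = digit_prefix k y L"
proof -
  let ?n = "digit_prefix k y L"
  have "real k ^ L * y \<noteq> real ?n"
  proof
    assume "real k ^ L * y = real ?n"
    then have "y = real ?n / real k ^ L"
      using assms(1) by (simp add: field_simps)
    moreover have "real ?n / real k ^ L \<in> \<rat>"
      by (intro Rats_divide Rats_power Rats_of_nat)
    ultimately show False
      using assms(2) by simp
  qed
  then have less: "real ?n < real k ^ L * y" "real k ^ L * y < real ?n + 1"
    using digit_prefix_bounds[OF assms(3), of k L] by auto
  have lim: "((\<lambda>z. real k ^ L * z) \<longlongrightarrow> real k ^ L * y) (nhds y)"
    by (intro tendsto_intros filterlim_ident)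
  have "\<forall>\<^sub>F z in nhds y. real ?n < real k ^ L * z" "\<forall>\<^sub>F z in nhds y. real k ^ L * z < real ?n + 1"
    using order_tendstoD[OF lim] less by blast+
  then show ?thesis
    by eventually_elim (rule digit_prefix_eqI, auto)
qed

text \<open>Weak convergence is tested on continuous functions of period 1. The squared sine of
  \<open>pi * (t - x)\<close> has this period and vanishes in \<open>[0, 1)\<close> only at
  \<open>x\<close>. With \<open>x\<close> in the open interval, a small bump does not wrap around to
  the other end.\<close>

lemma periodic_bumps:
  fixes x :: real
  assumes x: "x \<in> {0<..<1}"
  shows "\<exists>h :: nat \<Rightarrow> real \<Rightarrow> real.
    (\<forall>n. continuous_on UNIV (h n)) \<and> (\<forall>n t. h n (t + 1) = h n t) \<and>
    (\<forall>n t. 0 \<le> h n t \<and> h n t \<le> 1) \<and>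
    (\<forall>n. \<exists>\<epsilon>>0. \<forall>t. \<bar>t - x\<bar> \<le> \<epsilon> \<longrightarrow> h n t = 1) \<and>
    (\<forall>\<zeta>>0. \<forall>\<^sub>F n in sequentially. \<forall>t\<in>{0..<1}. h n t \<noteq> 0 \<longrightarrow> \<bar>t - x\<bar> < \<zeta>)"
proof -
  define D where "D t = (sin (pi * (t - x)))\<^sup>2" for t
  \<comment> \<open>\<open>h n\<close> is 1 where \<open>D t \<le> 1 / (n + 1)\<close> and 0 where
    \<open>D t \<ge> 2 / (n + 1)\<close>.\<close>
  define h where "h n t = max 0 (min 1 (2 - (real n + 1) * D t))" for n t
  have contD: "continuous_on S D" for S
    unfolding D_def by (intro continuous_intros)
  have cont: "continuous_on UNIV (h n)" for n
    unfolding h_def by (intro continuous_intros contD)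
  have "pi * (t + 1 - x) = pi * (t - x) + pi" for t
    by (simp add: algebra_simps)
  then have "D (t + 1) = D t" for t
    by (simp add: D_def)
  then have per: "h n (t + 1) = h n t" for n t
    by (simp add: h_def)
  have bounds: "0 \<le> h n t \<and> h n t \<le> 1" for n t
    by (simp_all add: h_def)
  have near: "\<exists>\<epsilon>>0. \<forall>t. \<bar>t - x\<bar> \<le> \<epsilon> \<longrightarrow> h n t = 1" for n
  proof -
    have "D \<midarrow>x\<rightarrow> D x"
      using contD[of UNIV] by (simp add: continuous_on_eq_continuous_at isCont_def)
    then have "\<forall>\<^sub>F t in at x. D t < 1 / (real n + 1)"
      by (rule order_tendstoD(2)) (simp add: D_def)
    then obtain e where e: "e > 0" "\<And>t. t \<noteq> x \<Longrightarrow> dist t x < e \<Longrightarrow> D t < 1 / (real n + 1)"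
      unfolding eventually_at by auto
    have "h n t = 1" if "\<bar>t - x\<bar> \<le> e / 2" for t
    proof -
      have "D t < 1 / (real n + 1)"
        using e that by (cases "t = x") (auto simp: dist_real_def D_def)
      then have "(real n + 1) * D t < 1"
        by (simp add: field_simps)
      then show ?thesis
        by (simp add: h_def)
    qed
    with e(1) show ?thesis
      by (intro exI[of _ "e / 2"]) auto
  qed
  have supp: "\<forall>\<^sub>F n in sequentially. \<forall>t\<in>{0..<1}. h n t \<noteq> 0 \<longrightarrow> \<bar>t - x\<bar> < \<zeta>" if "\<zeta> > 0" for \<zeta>
  proof -
    \<comment> \<open>On this compact set \<open>D\<close> has a positive minimum: a zero would lie
      at an integer distance from \<open>x\<close>, and \<open>0 < x < 1\<close> keeps even the
      endpoints closer than 1.\<close>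
    let ?S = "{0..1} \<inter> {t. \<zeta> \<le> \<bar>t - x\<bar>}"
    have "compact ?S"
      by (intro compact_Int_closed compact_Icc closed_Collect_le continuous_intros)
    obtain m where m: "m > 0" "\<And>t. t \<in> ?S \<Longrightarrow> m \<le> D t"
    proof (cases "?S = {}")
      case True
      then show ?thesis by (intro that[of 1]) auto
    next
      case False
      then obtain t0 where t0: "t0 \<in> ?S" "\<And>t. t \<in> ?S \<Longrightarrow> D t0 \<le> D t"
        using continuous_attains_inf[OF \<open>compact ?S\<close> _ contD] by blast
      have "sin (pi * (t0 - x)) \<noteq> 0"
      proof
        assume "sin (pi * (t0 - x)) = 0"
        then obtain i :: int where "pi * (t0 - x) = real_of_int i * pi"
          by (auto simp: sin_zero_iff_int2)
        then have i: "t0 - x = real_of_int i"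
          by (simp add: mult.commute)
        moreover have "\<bar>t0 - x\<bar> < 1"
          using t0(1) x by auto
        ultimately have "i = 0"
          by linarith
        with i t0(1) \<open>\<zeta> > 0\<close> show False
          by simp
      qed
      then show ?thesis
        using t0 by (intro that[of "D t0"]) (auto simp: D_def)
    qed
    have "\<forall>\<^sub>F n in sequentially. 2 / m \<le> real n"
      using filterlim_real_sequentially by (simp add: filterlim_at_top)
    then show ?thesis
    proof eventually_elim
      case (elim n)
      show ?case
      proof (intro ballI impI)
        fix t :: real assume t: "t \<in> {0..<1}" "h n t \<noteq> 0"
        show "\<bar>t - x\<bar> < \<zeta>"
        proof (rule ccontr)
          assume "\<not> \<bar>t - x\<bar> < \<zeta>"
          with t(1) have "m \<le> D t"
            by (intro m(2)) auto
          then have "(real n + 1) * m \<le> (real n + 1) * D t"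
            by (intro mult_left_mono) auto
          moreover have "2 \<le> (real n + 1) * m"
            using elim m(1) by (simp add: pos_divide_le_eq distrib_right)
          ultimately have "h n t = 0"
            unfolding h_def by linarith
          with t(2) show False by simp
        qed
      qed
    qed
  qed
  show ?thesis
    by (intro exI[of _ h] conjI allI impI cont per near supp bounds[THEN conjunct1]
        bounds[THEN conjunct2])
qed

text \<open>The bumps shrink pointwise to the indicator of \<open>{x}\<close> and are bounded by 1,
  so dominated convergence applies. Each of them also lies above that indicator.\<close>

lemma integral_bumps_tendsto_atom:
  fixes h :: "nat \<Rightarrow> real \<Rightarrow> real"
  assumes \<mu>: "finite_measure \<mu>" "sets \<mu> = sets torus" and x: "x \<in> {0..<1}"
    and h: "\<And>n. h n \<in> borel_measurable borel" "\<And>n t. h n t \<ge> 0" "\<And>n t. h n t \<le> 1" "\<And>n. h n x = 1"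
    and supp: "\<And>\<zeta>. \<zeta> > 0 \<Longrightarrow>
      \<forall>\<^sub>F n in sequentially. \<forall>t\<in>{0..<1}. h n t \<noteq> 0 \<longrightarrow> \<bar>t - x\<bar> < \<zeta>"
  shows "(\<lambda>n. LINT t|\<mu>. h n t) \<longlonglongrightarrow> measure \<mu> {x}" and "measure \<mu> {x} \<le> (LINT t|\<mu>. h n t)"
proof -
  interpret finite_measure \<mu> by (rule \<mu>(1))
  have space: "space \<mu> = {0..<1}"
    using sets_eq_imp_space_eq[OF \<mu>(2)] by (simp add: torus_def space_restrict_space)
  have "{x} \<in> sets torus"
    using x unfolding torus_def by (subst sets_restrict_space_iff) auto
  then have X: "{x} \<in> sets \<mu>"
    by (simp add: \<mu>(2))
  have meas: "h n \<in> borel_measurable \<mu>" for n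
  proof -
    have "h n \<in> borel_measurable torus"
      unfolding torus_def using h(1) by (rule measurable_restrict_space1)
    then show ?thesis
      by (simp cong: measurable_cong_sets add: \<mu>(2))
  qed
  have int: "integrable \<mu> (h n)" for n
    using h(2,3) by (intro integrable_const_bound[of _ 1] meas) auto
  have eq: "(LINT t|\<mu>. indicator {x} t) = measure \<mu> {x}"
    using X by simp
  have indint: "integrable \<mu> (indicator {x} :: real \<Rightarrow> real)"
    using X by (simp add: less_top[symmetric])
  have "(LINT t|\<mu>. indicator {x} t) \<le> (LINT t|\<mu>. h n t)"
    using h(2,4) by (intro integral_mono int indint) (auto simp: indicator_def)
  then show "measure \<mu> {x} \<le> (LINT t|\<mu>. h n t)"
    unfolding eq .
  have "(\<lambda>n. LINT t|\<mu>. h n t) \<longlonglongrightarrow> (LINT t|\<mu>. indicator {x} t)"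
  proof (rule integral_dominated_convergence[where w = "\<lambda>_. 1"])
    show "AE t in \<mu>. (\<lambda>n. h n t) \<longlonglongrightarrow> indicator {x} t"
    proof (rule AE_I2)
      fix t assume t: "t \<in> space \<mu>"
      show "(\<lambda>n. h n t) \<longlonglongrightarrow> indicator {x} t"
      proof (cases "t = x")
        case True
        then show ?thesis by (simp add: h(4))
      next
        case False
        then have "\<forall>\<^sub>F n in sequentially. \<forall>s\<in>{0..<1}. h n s \<noteq> 0 \<longrightarrow> \<bar>s - x\<bar> < \<bar>t - x\<bar>"
          by (intro supp) simp
        then have "\<forall>\<^sub>F n in sequentially. h n t = indicator {x} t"
          using t False by (auto simp: space elim!: eventually_mono)
        then show ?thesis
          by (rule tendsto_eventually)
      qed
    qed
  qed (use h meas X in auto)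
  then show "(\<lambda>n. LINT t|\<mu>. h n t) \<longlonglongrightarrow> measure \<mu> {x}"
    unfolding eq .
qed

section \<open>Concentration at an irrational atom\<close>

text \<open>Eventually along \<open>\<phi>\<close>, the share of a cylinder around \<open>x\<close>
  is at least \<open>\<alpha> - \<epsilon>\<close>, since irrationality leaves room for a bump
  inside it. For long prefixes it is at most \<open>\<alpha> + \<epsilon>\<close>, since the
  cylinder fits where a bump is 1. The quotient of the two bounds is
  \<open>\<theta>\<close>.\<close>

lemma atom_concentration:
  assumes k: "k \<ge> 2" and f: "\<And>n. f n \<ge> 0"
    and \<mu>: "finite_measure \<mu>" "sets \<mu> = sets torus"
    and \<phi>: "filterlim \<phi> at_top sequentially" "\<And>n. level_sum k f (\<phi> n) \<noteq> 0"
    and wl: "weak_limit (\<lambda>n. level_measure k f (\<phi> n)) \<mu>"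
    and x: "x \<in> {0..<1}" "x \<notin> \<rat>" and atom: "measure \<mu> {x} \<noteq> 0"
    and \<theta>: "0 < \<theta>" "\<theta> < 1"
  defines "y \<equiv> 1 + (real k - 1) * x"
  shows "\<exists>L0. \<forall>L\<ge>L0. \<forall>l. \<forall>\<^sub>F n in sequentially.
    0 < block_sum k f (digit_prefix k y L) (\<phi> n - L) \<and>
    \<theta> * block_sum k f (digit_prefix k y L) (\<phi> n - L)
      \<le> block_sum k f (digit_prefix k y (L + l)) (\<phi> n - (L + l))"
proof -
  define \<alpha> where "\<alpha> = measure \<mu> {x}"
  \<comment> \<open>Chosen so that
    \<open>\<theta> * (\<alpha> + \<epsilon>) = \<alpha> - \<epsilon>\<close>.\<close>
  define \<epsilon> where "\<epsilon> = \<alpha> * (1 - \<theta>) / (1 + \<theta>)"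
  have \<alpha>: "\<alpha> > 0"
    using atom by (simp add: \<alpha>_def less_le)
  have \<epsilon>: "\<epsilon> > 0"
    using \<alpha> \<theta> by (simp add: \<epsilon>_def)
  have split: "\<alpha> - \<epsilon> = 2 * \<alpha> * \<theta> / (1 + \<theta>)" "\<alpha> + \<epsilon> = 2 * \<alpha> / (1 + \<theta>)"
    using \<theta> by (simp_all add: \<epsilon>_def field_simps)
  have \<epsilon>': "\<alpha> - \<epsilon> > 0" "\<theta> * (\<alpha> + \<epsilon>) \<le> \<alpha> - \<epsilon>"
  proof -
    show "\<alpha> - \<epsilon> > 0"
      unfolding split using \<alpha> \<theta> by simp
    have "\<theta> * (2 * \<alpha> / (1 + \<theta>)) = 2 * \<alpha> * \<theta> / (1 + \<theta>)"
      by simp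
    then show "\<theta> * (\<alpha> + \<epsilon>) \<le> \<alpha> - \<epsilon>"
      unfolding split by (simp only: order_refl)
  qed
  have "x \<noteq> 0"
    using x(2) by auto
  with x(1) have "x \<in> {0<..<1}"
    by auto
  from periodic_bumps[OF this] obtain h :: "nat \<Rightarrow> real \<Rightarrow> real" where
    h: "(\<forall>n. continuous_on UNIV (h n)) \<and> (\<forall>n t. h n (t + 1) = h n t) \<and>
      (\<forall>n t. 0 \<le> h n t \<and> h n t \<le> 1) \<and>
      (\<forall>n. \<exists>\<epsilon>>0. \<forall>t. \<bar>t - x\<bar> \<le> \<epsilon> \<longrightarrow> h n t = 1) \<and>
      (\<forall>\<zeta>>0. \<forall>\<^sub>F n in sequentially. \<forall>t\<in>{0..<1}. h n t \<noteq> 0 \<longrightarrow> \<bar>t - x\<bar> < \<zeta>)"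
    by (rule exE)
  then have cont: "continuous_on UNIV (h n)" and per: "\<forall>t. h n (t + 1) = h n t"
    and h0: "h n t \<ge> 0" and h1: "h n t \<le> 1"
    and near: "\<exists>\<epsilon>>0. \<forall>t. \<bar>t - x\<bar> \<le> \<epsilon> \<longrightarrow> h n t = 1" for n t
    by simp_all
  from h have supp: "\<forall>\<^sub>F n in sequentially. \<forall>t\<in>{0..<1}. h n t \<noteq> 0 \<longrightarrow> \<bar>t - x\<bar> < \<zeta>"
    if "\<zeta> > 0" for \<zeta>
    using that by blast
  have meas: "h n \<in> borel_measurable borel" for n
    using cont by (rule borel_measurable_continuous_onI)
  have hx: "h n x = 1" for n
    using near[of n] by force
  note atomint = integral_bumps_tendsto_atom[OF \<mu> x(1) meas h0 h1 hx supp, folded \<alpha>_def]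
  have pos: "level_sum k f (\<phi> n) > 0" for n
    using level_sum_pos[of f k "\<phi> n"] f \<phi>(2) by blast
  define E where "E i n = (\<Sum>m = k ^ \<phi> n..<k ^ (\<phi> n + 1). f m * h i (level_point k (\<phi> n) m))" for i n
  have lim: "(\<lambda>n. E i n / level_sum k f (\<phi> n)) \<longlonglongrightarrow> (LINT t|\<mu>. h i t)" for i
  proof -
    have "(\<lambda>n. LINT t|level_measure k f (\<phi> n). h i t) \<longlonglongrightarrow> (LINT t|\<mu>. h i t)"
      using wl cont[of i] per[of i] unfolding weak_limit_def by blast
    moreover have "(LINT t|level_measure k f (\<phi> n). h i t) = E i n / level_sum k f (\<phi> n)" for n
      unfolding E_def by (rule integral_level_measure[OF k f pos meas])
    ultimately show ?thesis by simp
  qed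
  have large: "\<forall>\<^sub>F n in sequentially. K \<le> \<phi> n" for K
    using \<phi>(1) by (simp add: filterlim_at_top)
  have lower: "\<forall>\<^sub>F n in sequentially.
      (\<alpha> - \<epsilon>) * level_sum k f (\<phi> n) \<le> block_sum k f (digit_prefix k y K) (\<phi> n - K)" for K
  proof -
    have y_irr: "y \<notin> \<rat>"
    proof
      assume "y \<in> \<rat>"
      then have "(y - 1) / (real k - 1) \<in> \<rat>"
        by (intro Rats_divide Rats_diff Rats_of_nat Rats_1)
      then show False
        using x(2) k by (simp add: y_def)
    qed
    have "\<forall>\<^sub>F z in nhds y. digit_prefix k z K = digit_prefix k y K"
      by (rule digit_prefix_locally_constant) (use k x y_irr in \<open>auto simp: y_def\<close>)
    then obtain e where e: "e > 0" "\<And>z. dist z y < e \<Longrightarrow> digit_prefix k z K = digit_prefix k y K"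
      unfolding eventually_nhds_metric by blast
    \<comment> \<open>Passing from \<open>x\<close> to \<open>y\<close> stretches distances by
      \<open>k - 1 < k\<close>, so this radius stays within \<open>e\<close>.\<close>
    have "e / real k > 0"
      using e(1) k by simp
    from eventually_happens'[OF sequentially_bot supp[OF this]]
    obtain i where i: "\<And>t. t \<in> {0..<1} \<Longrightarrow> h i t \<noteq> 0 \<Longrightarrow> \<bar>t - x\<bar> < e / real k"
      by blast
    have "digit_prefix k (1 + (real k - 1) * t) K = digit_prefix k y K"
      if "t \<in> {0..<1}" "h i t \<noteq> 0" for t
    proof (rule e(2))
      have "dist (1 + (real k - 1) * t) y = \<bar>(real k - 1) * (t - x)\<bar>"
        by (simp add: y_def dist_real_def right_diff_distrib)
      also have "\<dots> = (real k - 1) * \<bar>t - x\<bar>"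
        using k by (simp add: abs_mult)
      also have "\<dots> \<le> real k * \<bar>t - x\<bar>"
        by (intro mult_right_mono) auto
      also have "\<dots> < e"
        using i[OF that] k by (simp add: field_simps)
      finally show "dist (1 + (real k - 1) * t) y < e" .
    qed
    then have block: "E i n \<le> block_sum k f (digit_prefix k y K) (\<phi> n - K)" if "K \<le> \<phi> n" for n
      unfolding E_def y_def
      by (intro level_integral_le_block_sum k f x(1) that h1) (auto simp: y_def)
    have "\<alpha> - \<epsilon> < (LINT t|\<mu>. h i t)"
      using atomint(2)[of i] \<epsilon> by linarith
    then have "\<forall>\<^sub>F n in sequentially. \<alpha> - \<epsilon> < E i n / level_sum k f (\<phi> n)"
      by (rule order_tendstoD(1)[OF lim])
    then show ?thesis
      using large[of K]
    proof eventually_elim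
      case (elim n)
      then have "(\<alpha> - \<epsilon>) * level_sum k f (\<phi> n) \<le> E i n"
        using pos[of n] by (simp add: pos_less_divide_eq)
      with block[of n] elim show ?case by simp
    qed
  qed
  have "\<forall>\<^sub>F i in sequentially. (LINT t|\<mu>. h i t) < \<alpha> + \<epsilon>"
    using order_tendstoD(2)[OF atomint(1)] \<epsilon> by simp
  \<comment> \<open>One bump with integral close to the atom serves all long prefixes, because it is
    1 on a whole neighbourhood of \<open>x\<close>.\<close>
  then obtain i where i: "(LINT t|\<mu>. h i t) < \<alpha> + \<epsilon>"
    using eventually_happens'[OF sequentially_bot] by blast
  obtain e where e: "e > 0" "\<And>t. \<bar>t - x\<bar> \<le> e \<Longrightarrow> h i t = 1"
    using near by blast
  obtain L0 where L0: "(1 / real k) ^ L0 < e"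
    using real_arch_pow_inv[OF e(1), of "1 / real k"] k by auto
  have upper: "\<forall>\<^sub>F n in sequentially.
      block_sum k f (digit_prefix k y L) (\<phi> n - L) \<le> (\<alpha> + \<epsilon>) * level_sum k f (\<phi> n)" if L: "L \<ge> L0" for L
  proof -
    have "(1 / real k) ^ L \<le> (1 / real k) ^ L0"
      using L k by (intro power_decreasing) auto
    then have "1 / real k ^ L \<le> e"
      using L0 by (simp add: power_one_over)
    then have "h i t = 1" if "\<bar>t - x\<bar> \<le> 1 / real k ^ L" for t
      using that by (intro e(2)) simp
    then have block: "block_sum k f (digit_prefix k y L) (\<phi> n - L) \<le> E i n" if "L \<le> \<phi> n" for n
      unfolding E_def y_def by (intro block_sum_le_level_integral k f x(1) that h0)
    have "\<forall>\<^sub>F n in sequentially. E i n / level_sum k f (\<phi> n) < \<alpha> + \<epsilon>"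
      by (rule order_tendstoD(2)[OF lim i])
    then show ?thesis
      using large[of L]
    proof eventually_elim
      case (elim n)
      then have "E i n \<le> (\<alpha> + \<epsilon>) * level_sum k f (\<phi> n)"
        using pos[of n] by (simp add: pos_divide_less_eq)
      with block[of n] elim show ?case by simp
    qed
  qed
  show ?thesis
  proof (intro exI[of _ L0] allI impI)
    fix L l assume "L \<ge> L0"
    from upper[OF this] lower[of L] lower[of "L + l"]
    show "\<forall>\<^sub>F n in sequentially.
      0 < block_sum k f (digit_prefix k y L) (\<phi> n - L) \<and>
      \<theta> * block_sum k f (digit_prefix k y L) (\<phi> n - L)
        \<le> block_sum k f (digit_prefix k y (L + l)) (\<phi> n - (L + l))"
    proof eventually_elim
      case (elim n)
      let ?S = "level_sum k f (\<phi> n)"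
      have "0 < (\<alpha> - \<epsilon>) * ?S"
        using \<epsilon>'(1) pos[of n] by simp
      have "\<theta> * block_sum k f (digit_prefix k y L) (\<phi> n - L) \<le> \<theta> * ((\<alpha> + \<epsilon>) * ?S)"
        using elim(1) \<theta>(1) by (intro mult_left_mono) auto
      also have "\<dots> = \<theta> * (\<alpha> + \<epsilon>) * ?S"
        by simp
      also have "\<dots> \<le> (\<alpha> - \<epsilon>) * ?S"
        using \<epsilon>'(2) pos[of n] by (intro mult_right_mono) auto
      finally show ?case
        using elim(2,3) \<open>0 < (\<alpha> - \<epsilon>) * ?S\<close> by linarith
    qed
  qed
qed

section \<open>Prefix vectors of a canonical representation\<close>

lemma inner_orth_proj:
  fixes V :: "(real^'d) set"
  assumes "real_vector.subspace V" "z \<in> V"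
  shows "inner z (orth_proj V *v x) = inner z x"
proof -
  have "inner z (x - orth_proj V *v x) = 0"
    using orth_proj_diff[OF assms(1), of x] assms(2)
    by (auto simp: orthogonal_comp_def orthogonal_def)
  then show ?thesis
    by (simp add: inner_diff_right)
qed

text \<open>Paired with any vector, the left projection is absorbed by \<open>z\<close> and the
  right one by \<open>z v* M\<close>, since both row vectors lie in the reach space.\<close>

lemma restr_mat_on_reach_space:
  assumes "z \<in> reach_space k u A" "z v* M \<in> reach_space k u A"
  shows "z v* restr_mat k u A M = z v* M"
proof -
  have V: "real_vector.subspace (reach_space k u A)"
    by (simp add: reach_space_def)
  have "inner (z v* restr_mat k u A M) x = inner (z v* M) x" for x
    using inner_orth_proj[OF V assms(1)] inner_orth_proj[OF V assms(2)]
    by (simp add: restr_mat_def dot_lmul_matrix flip: matrix_vector_mul_assoc)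
  then show ?thesis
    using vector_eq_rdot by blast
qed

text \<open>The recursion of \<open>F\<close> appends a digit just as \<open>digit_prod\<close>
  does, starting from \<open>u\<close> at 0. In the application \<open>F\<close> consists of kernel
  sequences, so the row vectors inherit the sign of \<open>f\<close>.\<close>

lemma canonical_rep_prefix_vector:
  assumes k: "k \<ge> 2" and F: "\<And>n j. j < k \<Longrightarrow> (\<chi> i. F i (k * n + j)) = (\<chi> i. F i n) v* A j"
    and u: "u = (\<chi> i. F i 0)"
  shows "u v* digit_prod k A n = (\<chi> i. F i n)"
proof (induction n rule: less_induct)
  case (less n)
  show ?case
  proof (cases "n = 0")
    case True
    then show ?thesis by (simp add: digit_prod_0 u)
  next
    case False
    have n: "k * (n div k) + n mod k = n"
      by simp
    have "digit_prod k A n = digit_prod k A (n div k) ** A (n mod k)"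
      using digit_prod_step[of k "n mod k" "n div k" A] k False by simp
    then have "u v* digit_prod k A n = (\<chi> i. F i (n div k)) v* A (n mod k)"
      using less.IH[of "n div k"] False k by (simp flip: vector_matrix_mul_assoc)
    also have "\<dots> = (\<chi> i. F i n)"
      using F[of "n mod k" "n div k"] k unfolding n by simp
    finally show ?thesis .
  qed
qed

section \<open>Rationality of the atoms of ghost measures\<close>

theorem theorem6:
  fixes k :: nat
    and f :: "nat \<Rightarrow> real"
    and u v :: "real^'d"
    and A :: "nat \<Rightarrow> real^'d^'d"
    and \<mu> :: "real measure"
  assumes "k \<ge> 2"
    and "k_regular k f"
    and "\<And>n. f n \<ge> 0"
    and "nondegenerate TYPE('d) k f"
    and "canonical_rep k f u A v"
    and "\<And>i. i < k \<Longrightarrow> restr_mat k u A (A i) \<ge> 0"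
    and "v \<ge> 0"
    and "ghost_measure k f \<mu>"
  shows "emeasure (pure_point_part \<mu>) (space \<mu> - \<rat>) = 0"
proof -
  define w where "w n = u v* digit_prod k A n" for n
  obtain F :: "'d \<Rightarrow> nat \<Rightarrow> real" where F: "range F \<subseteq> kernel k f"
      "\<And>n j. j < k \<Longrightarrow> (\<chi> i. F i (k * n + j)) = (\<chi> i. F i n) v* A j" "u = (\<chi> i. F i 0)"
    and rep: "linear_rep k f u A v"
    using assms(5) unfolding canonical_rep_def by blast
  \<comment> \<open>Members of the kernel are subsequences of \<open>f\<close>.\<close>
  have "F i n \<ge> 0" for i n
  proof -
    have "F i \<in> kernel k f"
      using F(1) by blast
    then show ?thesis
      using assms(3) by (auto simp: kernel_def)
  qed
  moreover have "w n = (\<chi> i. F i n)" for n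
    unfolding w_def by (rule canonical_rep_prefix_vector[OF assms(1) F(2,3)])
  ultimately have w0: "w n \<ge> 0" for n
    by (simp add: less_eq_vec_def)
  have w_reach: "w n \<in> reach_space k u A" if "n \<ge> 1" for n
    unfolding reach_space_def w_def using that by (intro span_base) auto
  \<comment> \<open>\<open>n \<ge> 1\<close> puts both \<open>w n\<close> and its successor in the
    reach space, where the restricted matrix acts as \<open>A i\<close>.\<close>
  have w_step: "w (k * n + i) = w n v* restr_mat k u A (A i)" if "n \<ge> 1" "i < k" for n i
  proof -
    have eq: "w (k * n + i) = w n v* A i"
      using that assms(1) by (simp add: w_def digit_prod_step vector_matrix_mul_assoc)
    have "k * n + i \<ge> 1"
      using that assms(1) by (cases "k * n") auto
    from w_reach[OF this] show ?thesis
      using w_reach[OF that(1)] unfolding eq by (simp add: restr_mat_on_reach_space)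
  qed
  have fw: "f n = inner (w n) v" for n
    using rep by (simp add: linear_rep_def w_def dot_lmul_matrix)
  obtain \<phi> where \<mu>: "prob_space \<mu>" "sets \<mu> = sets torus" and \<phi>: "strict_mono \<phi>"
      "\<And>n. level_sum k f (\<phi> n) \<noteq> 0" "weak_limit (\<lambda>n. level_measure k f (\<phi> n)) \<mu>"
    using assms(8) unfolding ghost_measure_def by blast
  have fin: "finite_measure \<mu>"
    using \<mu>(1) by (rule prob_space.finite_measure)
  have space: "space \<mu> = {0..<1}"
    using sets_eq_imp_space_eq[OF \<mu>(2)] by (simp add: torus_def space_restrict_space)
  have \<phi>_top: "filterlim \<phi> at_top sequentially"
    using \<phi>(1) by (rule filterlim_subseq)
  have rational: "x \<in> \<rat>" if x: "x \<in> space \<mu>" "measure \<mu> {x} \<noteq> 0" for x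
  proof (rule ccontr)
    assume irr: "x \<notin> \<rat>"
    have x01: "x \<in> {0..<1}"
      using x(1) by (simp add: space)
    \<comment> \<open>The argument runs on this number, whose prefixes index the cylinders; the
      affine map has rational coefficients, so rationality passes back to \<open>x\<close>.\<close>
    have "1 + (real k - 1) * x \<in> \<rat>"
    proof (rule concentration_imp_rational[where B = "\<lambda>i. restr_mat k u A (A i)" and w = w and \<phi> = \<phi>])
      show "1 \<le> 1 + (real k - 1) * x"
        using x01 assms(1) by simp
      show "f n = inner (w n) v" for n
        by (rule fw)
    qed (use assms(1,6,7) w0 w_step \<phi>_top in
        \<open>auto intro: atom_concentration[OF assms(1,3) fin \<mu>(2) \<phi>_top \<phi>(2,3) x01 irr x(2)]\<close>)
    then have "(1 + (real k - 1) * x - 1) / (real k - 1) \<in> \<rat>"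
      by (intro Rats_divide Rats_diff Rats_of_nat Rats_1)
    with irr assms(1) show False
      by simp
  qed
  have singleton: "{x} \<in> sets \<mu>" if "x \<in> space \<mu>" for x
    using that unfolding \<mu>(2) space torus_def by (subst sets_restrict_space_iff) auto
  have "space \<mu> - \<rat> \<in> sets \<mu>"
  proof -
    have "space \<mu> \<inter> \<rat> \<in> sets \<mu>"
      by (rule sets.countable) (use singleton countable_rat in \<open>auto intro: countable_subset\<close>)
    then have "space \<mu> - space \<mu> \<inter> \<rat> \<in> sets \<mu>"
      by (rule sets.compl_sets)
    moreover have "space \<mu> - space \<mu> \<inter> \<rat> = space \<mu> - \<rat>"
      by auto
    ultimately show ?thesis by simp
  qed
  then have "emeasure (pure_point_part \<mu>) (space \<mu> - \<rat>) =
      emeasure \<mu> ((space \<mu> - \<rat>) \<inter> {x \<in> space \<mu>. measure \<mu> {x} \<noteq> 0})"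
    by (intro emeasure_pure_point_part fin singleton)
  also have "(space \<mu> - \<rat>) \<inter> {x \<in> space \<mu>. measure \<mu> {x} \<noteq> 0} = {}"
    using rational by auto
  finally show ?thesis
    by simp
qed

end
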